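(* For an abelian group $G$ (written additively) the following assertions are equivalent, where all rings are commutative: (i) $G$ is a totally ordered group (i.e. $G$ admits a total order making it a totally ordered group). (ii) $G$ is a torsion-free group. (iii) The nilradical of every $G$-graded ring is a graded ideal. (iv) For each prime number $p$, the nilradical of the group-ring $(\mathbb Z/p)[G]$ is a graded ideal. (v) The Jacobson radical of every $G$-graded ring is a graded ideal. (vi) For each prime number $p$, the Jacobson radical of the group-ring $(\mathbb Z/p)[G]$ is a graded ideal. (vii) The idempotents of every $G$-graded ring are contained in its base subring. (viii) For any ring $R$, every idempotent of the group-ring $R[G]$ is contained in $R$. (ix) For any field $K$, the group-ring $K[G]$ has no nontrivial idempotents. (x) The group-ring $\mathbb Q[G]$ has no nontrivial idempotents. (xi) For any integral domain $R$, the group-ring $R[G]$ is an integral domain. (xii) The group-ring $\mathbb Q[G]$ is an integral domain. (xiii) For any integral domain $R$, the units of the group-ring $R[G]$ are precisely the elements of the form $r\epsilon_g$ with $r$ invertible in $R$ and $g\in G$. (xiv) The units of the group-ring $\mathbb Q[G]$ are precisely the elements of the form $r\epsilon_g$ with $0\neq r\in\mathbb Q$ and $g\in G$.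
   Context: Rings have an identity. A $G$-graded ring is a ring $R$ with a decomposition $R=\bigoplus_{n\in G}R_n$ of its additive group into subgroups with $R_mR_n\subseteq R_{m+n}$ for all $m,n\in G$; its base subring is $R_0$. An ideal $I$ is graded if for every $f=\sum_n r_n\in I$ with $r_n\in R_n$, all $r_n$ lie in $I$. A totally ordered abelian group is an abelian group with a total order such that $a<b$ implies $a+x<b+x$. $R[G]$ is the free $R$-module with basis $\{\epsilon_x: x\in G\}$ and multiplication determined $R$-bilinearly by $\epsilon_x\epsilon_y=\epsilon_{x+y}$, graded by the components $R\epsilon_x$; $R$ is identified with $R\epsilon_0$. Trivial idempotents are $0$ and $1$. *)

theory Defs
  imports "HOL-Number_Theory.Residues" "HOL-Algebra.Algebraic_Closure_Type"
begin

section \<open>Abelian groups\<close>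

definition totally_orderable :: "'g::ab_group_add itself \<Rightarrow> bool" where
  "totally_orderable _ \<longleftrightarrow>
    (\<exists>(le :: 'g \<Rightarrow> 'g \<Rightarrow> bool) lt. class.linorder le lt \<and>
      (\<forall>a b x. lt a b \<longrightarrow> lt (a + x) (b + x)))"

text \<open>The sum below is the multiple \<open>n x\<close>.\<close>

definition torsion_free :: "'g::ab_group_add itself \<Rightarrow> bool" where
  "torsion_free _ \<longleftrightarrow> (\<forall>(x :: 'g) (n :: nat). n > 0 \<and> (\<Sum>i<n. x) = 0 \<longrightarrow> x = 0)"


section \<open>Commutative graded rings\<close>

definition homogeneous_decomp ::
  "('r, 'm) ring_scheme \<Rightarrow> ('g \<Rightarrow> 'r set) \<Rightarrow> 'r \<Rightarrow> ('g \<Rightarrow> 'r) \<Rightarrow> bool" where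
  "homogeneous_decomp R A f c \<longleftrightarrow>
    (\<forall>n. c n \<in> A n) \<and> finite {n. c n \<noteq> \<zero>\<^bsub>R\<^esub>} \<and>
    f = (\<Oplus>\<^bsub>R\<^esub>n\<in>{n. c n \<noteq> \<zero>\<^bsub>R\<^esub>}. c n)"

text \<open>\<open>A n\<close> is the homogeneous component \<open>R\<^sub>n\<close>; the last assumption says that the additive group
  of \<open>R\<close> is the internal direct sum of the components. The zero ring is allowed.\<close>

locale graded_cring = cring R for R (structure) +
  fixes A :: "'g::ab_group_add \<Rightarrow> 'a set"
  assumes component_subgroup: "additive_subgroup (A n) R"
    and component_mult: "\<lbrakk>x \<in> A m; y \<in> A n\<rbrakk> \<Longrightarrow> x \<otimes> y \<in> A (m + n)"
    and direct_sum: "f \<in> carrier R \<Longrightarrow> \<exists>!c. homogeneous_decomp R A f c"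

definition graded_ideal :: "('r, 'm) ring_scheme \<Rightarrow> ('g \<Rightarrow> 'r set) \<Rightarrow> 'r set \<Rightarrow> bool" where
  "graded_ideal R A I \<longleftrightarrow>
    ideal I R \<and> (\<forall>f\<in>I. \<forall>c. homogeneous_decomp R A f c \<longrightarrow> (\<forall>n. c n \<in> I))"

definition nilradical :: "('r, 'm) ring_scheme \<Rightarrow> 'r set" where
  "nilradical R = {x \<in> carrier R. \<exists>k::nat. x [^]\<^bsub>R\<^esub> k = \<zero>\<^bsub>R\<^esub>}"

text \<open>The intersection of all maximal ideals, taken inside the carrier, so that the Jacobson
  radical of the zero ring is the zero ring itself.\<close>

definition jacobson_radical :: "('r, 'm) ring_scheme \<Rightarrow> 'r set" where
  "jacobson_radical R = {x \<in> carrier R. \<forall>M. maximalideal M R \<longrightarrow> x \<in> M}"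

definition idempotents :: "('r, 'm) ring_scheme \<Rightarrow> 'r set" where
  "idempotents R = {e \<in> carrier R. e \<otimes>\<^bsub>R\<^esub> e = e}"


section \<open>Group rings\<close>

text \<open>The element \<open>r \<epsilon>\<^sub>g\<close> of \<open>R[G]\<close>.\<close>

definition gmonom :: "('r, 'm) ring_scheme \<Rightarrow> 'r \<Rightarrow> 'g \<Rightarrow> 'g \<Rightarrow> 'r" where
  "gmonom R r g = (\<lambda>x. if x = g then r else \<zero>\<^bsub>R\<^esub>)"

text \<open>An element \<open>\<Sum>\<^sub>x r\<^sub>x \<epsilon>\<^sub>x\<close> of \<open>R[G]\<close> is represented by its finitely supported coefficient
  function \<open>x \<mapsto> r\<^sub>x\<close>. The product is the bilinear extension of
  \<open>\<epsilon>\<^sub>x \<epsilon>\<^sub>y = \<epsilon>\<^sub>x\<^sub>+\<^sub>y\<close>: the coefficient at \<open>z\<close> sums over the pairs in the supports with \<open>x + y = z\<close>.\<close>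

definition group_ring ::
  "'g::ab_group_add itself \<Rightarrow> ('r, 'm) ring_scheme \<Rightarrow> ('g \<Rightarrow> 'r) ring" where
  "group_ring _ R =
    \<lparr>carrier = {f. (\<forall>x. f x \<in> carrier R) \<and> finite {x. f x \<noteq> \<zero>\<^bsub>R\<^esub>}},
     monoid.mult = (\<lambda>f h z.
       \<Oplus>\<^bsub>R\<^esub>q\<in>{(x, y). f x \<noteq> \<zero>\<^bsub>R\<^esub> \<and> h y \<noteq> \<zero>\<^bsub>R\<^esub> \<and> x + y = z}. f (fst q) \<otimes>\<^bsub>R\<^esub> h (snd q)),
     one = gmonom R \<one>\<^bsub>R\<^esub> 0,
     zero = (\<lambda>x. \<zero>\<^bsub>R\<^esub>),
     add = (\<lambda>f h x. f x \<oplus>\<^bsub>R\<^esub> h x)\<rparr>"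

text \<open>\<open>group_ring_component R g\<close> is \<open>R \<epsilon>\<^sub>g\<close>; for \<open>g = 0\<close> it is the copy of \<open>R\<close> inside \<open>R[G]\<close>.\<close>

definition group_ring_component :: "('r, 'm) ring_scheme \<Rightarrow> 'g \<Rightarrow> ('g \<Rightarrow> 'r) set" where
  "group_ring_component R g = {gmonom R r g | r. r \<in> carrier R}"

abbreviation rat_ring :: "rat ring" where
  "rat_ring \<equiv> ring_of_type_algebra"

text \<open>Quantification over ``every ring'' in the theorem is over all \<open>R :: 'r ring\<close>, i.e. over all rings
  carried by a subset of an arbitrary infinite type \<open>'r\<close>. Every ring has an isomorphic copy carried by
  a subset of some such type.\<close>

end

theory Submission
  imports Defs "HOL-Library.Countable_Set"
begin

text \<open>A torsion-free group is totally ordered by a maximal cone. Over an ordered group, comparing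
  leading and lowest terms modulo a prime ideal \<open>P\<close> shows that a product with all components in \<open>P\<close> has
  such a factor, and that the factors of a product which is homogeneous modulo \<open>P\<close> are homogeneous
  modulo \<open>P\<close>. With \<open>P = 0\<close> this gives the domains and units of group rings. As the nilradical is the
  intersection of the primes, it also shows that the nilradical is graded and that the components of
  nonzero degree of an idempotent, of a unit with constant term \<open>1\<close>, and of an element of the
  Jacobson radical are nilpotent.

  Conversely, a group with torsion has a subgroup \<open>H\<close> of prime order \<open>p\<close>. The element
  \<open>s = \<Sum>\<^sub>h \<epsilon>\<^sub>h\<close>, summed over \<open>H\<close>, satisfies \<open>s\<^sup>2 = p s\<close>. Hence \<open>s\<close> is nilpotent over
  \<open>\<int>/p\<close> although its component in degree \<open>0\<close> is \<open>1\<close>, while over \<open>\<rat>\<close> the element \<open>s/p\<close> is a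
  nontrivial idempotent.\<close>

section \<open>Ordered and torsion-free abelian groups\<close>

text \<open>No cycle of implications is followed: an order yields every assertion, and an element of
  finite order refutes every assertion. On the torsion side the obstacle is the range of the
  quantifiers. The assertions on every graded ring speak of rings carried by a subset of an
  arbitrary infinite type \<open>'r\<close>, whereas \<open>s\<close> and \<open>s/p\<close> are
  functions on \<open>G\<close>, and the group ring may be too large to embed into
  \<open>'r\<close>. Finiteness of \<open>H\<close> removes the obstacle: over countable
  coefficients the elements supported on \<open>H\<close> form a countable subring, still graded by
  all of \<open>G\<close>, and a countable ring has a copy inside any infinite type. The assertions
  on units need one more construction, since an idempotent other than \<open>1\<close> is never a
  unit: for \<open>e = s/p\<close> the element \<open>1 + e\<close> is one. On the ordered side, an
  element of the Jacobson radical has to be multiplied by a suitable homogeneous element before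
  adding \<open>1\<close> produces a unit whose constant term is \<open>1\<close>.\<close>

definition ntimes :: "nat \<Rightarrow> 'g::ab_group_add \<Rightarrow> 'g" where
  "ntimes n x = (\<Sum>i<n. x)"

lemma ntimes_0 [simp]: "ntimes 0 x = 0"
  and ntimes_Suc: "ntimes (Suc n) x = x + ntimes n x"
  by (simp_all add: ntimes_def add.commute)

lemma ntimes_zero [simp]: "ntimes n 0 = 0"
  by (simp add: ntimes_def)

lemma ntimes_add: "ntimes (m + n) x = ntimes m x + ntimes n x"
  by (induction m) (simp_all add: ntimes_Suc add.assoc)

lemma ntimes_mult: "ntimes (m * n) x = ntimes m (ntimes n x)"
  by (induction m) (simp_all add: ntimes_Suc ntimes_add)

lemma ntimes_uminus: "ntimes n (- x) = - ntimes n x"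
  by (simp add: ntimes_def sum_negf)

lemma torsion_free_iff:
  "torsion_free TYPE('g::ab_group_add) \<longleftrightarrow> (\<forall>(x::'g) n. n > 0 \<and> ntimes n x = 0 \<longrightarrow> x = 0)"
  by (simp add: torsion_free_def ntimes_def)

text \<open>Only the strict relation is kept. The reversed relation is again of this kind, so
  statements on greatest elements also serve for least elements.\<close>

definition group_order :: "('g::ab_group_add \<Rightarrow> 'g \<Rightarrow> bool) \<Rightarrow> bool" where
  "group_order lt \<longleftrightarrow> irreflp lt \<and> transp lt \<and> totalp lt \<and>
    (\<forall>a b x. lt a b \<longrightarrow> lt (a + x) (b + x))"

lemma group_orderD:
  assumes "group_order lt"
  shows "\<not> lt a a" and "lt a b \<Longrightarrow> lt b c \<Longrightarrow> lt a c" and "a \<noteq> b \<Longrightarrow> lt a b \<or> lt b a"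
    and "lt a b \<Longrightarrow> lt (a + x) (b + x)"
  using assms unfolding group_order_def
  by (auto dest: irreflpD transpD totalpD)

lemma group_order_dual: "group_order lt \<Longrightarrow> group_order (\<lambda>a b. lt b a)"
  unfolding group_order_def irreflp_def transp_def totalp_on_def by (elim conjE, intro conjI) blast+

lemma totally_orderable_iff:
  "totally_orderable TYPE('g::ab_group_add) \<longleftrightarrow> (\<exists>lt :: 'g \<Rightarrow> 'g \<Rightarrow> bool. group_order lt)"
proof
  assume "totally_orderable TYPE('g)"
  then obtain le lt :: "'g \<Rightarrow> 'g \<Rightarrow> bool" where "class.linorder le lt"
    and lt: "\<forall>a b x. lt a b \<longrightarrow> lt (a + x) (b + x)"
    unfolding totally_orderable_def by blast
  then interpret linorder le lt by simp
  have "group_order lt"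
    unfolding group_order_def irreflp_def transp_def totalp_on_def
    using lt by (auto intro: less_trans)
  then show "\<exists>lt :: 'g \<Rightarrow> 'g \<Rightarrow> bool. group_order lt" by blast
next
  assume "\<exists>lt :: 'g \<Rightarrow> 'g \<Rightarrow> bool. group_order lt"
  then obtain lt :: "'g \<Rightarrow> 'g \<Rightarrow> bool" where lt: "group_order lt" by blast
  have "class.linorder (\<lambda>a b. a = b \<or> lt a b) lt"
    by unfold_locales (use group_orderD[OF lt] in blast)+
  then show "totally_orderable TYPE('g)"
    unfolding totally_orderable_def using group_orderD(4)[OF lt] by blast
qed

lemma group_order_add_mono:
  assumes "group_order lt" and "a = b \<or> lt a b" and "lt c d"
  shows "lt (a + c) (b + d)"
  using assms group_orderD(2)[OF assms(1)] group_orderD(4)[OF assms(1)] by (metis add.commute)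

lemma group_order_greatest:
  assumes "group_order lt" and "finite S" and "S \<noteq> {}"
  shows "\<exists>m\<in>S. \<forall>x\<in>S. x = m \<or> lt x m"
  using assms(2,3)
proof (induction S rule: finite_ne_induct)
  case (insert x F)
  then obtain m where m: "m \<in> F" "\<forall>y\<in>F. y = m \<or> lt y m" by blast
  then consider "x = m" | "lt x m" | "lt m x" using group_orderD(3)[OF assms(1)] by blast
  then show ?case
    using m group_orderD(2)[OF assms(1)] by cases (metis insert_iff)+
qed simp

lemma group_order_ntimes_pos:
  assumes "group_order lt" and "lt 0 x" and "n > 0"
  shows "lt 0 (ntimes n x)"
  using assms(3)
proof (induction n rule: nat_induct_non_zero)
  case (Suc n)
  then show ?case
    using group_order_add_mono[OF assms(1), of 0 x 0 "ntimes n x"] assms(2) by (simp add: ntimes_Suc)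
qed (use assms in \<open>simp add: ntimes_Suc\<close>)

text \<open>Positive multiples of a positive element are positive, hence nonzero. A negative element
  is positive for the reversed order.\<close>

lemma group_order_imp_torsion_free:
  assumes "group_order (lt :: 'g::ab_group_add \<Rightarrow> 'g \<Rightarrow> bool)"
  shows "torsion_free TYPE('g)"
  unfolding torsion_free_iff
proof (intro allI impI)
  fix x :: 'g and n :: nat
  assume n: "n > 0 \<and> ntimes n x = 0"
  show "x = 0"
  proof (rule ccontr)
    assume "x \<noteq> 0"
    then have "lt 0 x \<or> lt x 0" using group_orderD(3)[OF assms] by blast
    then show False
      using n group_order_ntimes_pos[OF assms, of x n] group_orderD(1)[OF assms, of 0]
        group_order_ntimes_pos[OF group_order_dual[OF assms], of x n] by auto
  qed
qed

text \<open>The set of non-negative elements of a translation-invariant partial order, in which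
  \<open>a \<le> b\<close> means \<open>b - a \<in> P\<close>. Totality has to come from maximality
  of \<open>P\<close>.\<close>

definition positive_cone :: "'g::ab_group_add set \<Rightarrow> bool" where
  "positive_cone P \<longleftrightarrow> 0 \<in> P \<and> (\<forall>x\<in>P. \<forall>y\<in>P. x + y \<in> P) \<and> (\<forall>x. x \<in> P \<and> - x \<in> P \<longrightarrow> x = 0)"

lemma positive_cone_ntimes: "positive_cone P \<Longrightarrow> x \<in> P \<Longrightarrow> ntimes n x \<in> P"
  by (induction n) (simp_all add: ntimes_Suc positive_cone_def)

text \<open>The set \<open>Q\<close> of all \<open>p + n x\<close> is closed under addition and
  properly contains \<open>P\<close>, so by maximality it is not a cone and must contain some
  \<open>a \<noteq> 0\<close> together with \<open>- a\<close>. Adding their two representations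
  puts the negative of a multiple of \<open>x\<close> into \<open>P\<close>.\<close>

lemma maximal_positive_cone_multiple:
  assumes P: "positive_cone P" and max: "\<And>Q. positive_cone Q \<Longrightarrow> P \<subseteq> Q \<Longrightarrow> Q = P"
    and x: "x \<notin> P"
  shows "\<exists>k>0. - ntimes k x \<in> P"
proof -
  define Q where "Q = {p + ntimes n x | p n. p \<in> P}"
  have Q: "a \<in> Q \<longleftrightarrow> (\<exists>p n. p \<in> P \<and> a = p + ntimes n x)" for a
    unfolding Q_def by auto
  have P0: "0 \<in> P" using P unfolding positive_cone_def by blast
  have PQ: "P \<subseteq> Q"
  proof
    fix p assume "p \<in> P"
    moreover have "p = p + ntimes 0 x" by simp
    ultimately show "p \<in> Q" unfolding Q by metis
  qed
  have "x = 0 + ntimes 1 x" by (simp add: ntimes_Suc)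
  then have "x \<in> Q" unfolding Q using P0 by metis
  then have "\<not> positive_cone Q" using max PQ x by blast
  moreover have "0 \<in> Q" using PQ P0 by blast
  moreover have "a + b \<in> Q" if a: "a \<in> Q" and b: "b \<in> Q" for a b
  proof -
    obtain p m where p: "p \<in> P" "a = p + ntimes m x" using a unfolding Q by metis
    obtain q n where q: "q \<in> P" "b = q + ntimes n x" using b unfolding Q by metis
    have "a + b = (p + q) + ntimes (m + n) x" using p q by (simp add: ntimes_add algebra_simps)
    moreover have "p + q \<in> P" using p q P unfolding positive_cone_def by blast
    ultimately show ?thesis unfolding Q by metis
  qed
  ultimately obtain a where a: "a \<in> Q" "- a \<in> Q" "a \<noteq> 0" unfolding positive_cone_def by metis
  obtain p m where p: "p \<in> P" "a = p + ntimes m x" using a(1) unfolding Q by metis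
  obtain q n where q: "q \<in> P" "- a = q + ntimes n x" using a(2) unfolding Q by metis
  have "p + q + ntimes (m + n) x = (p + ntimes m x) + (q + ntimes n x)"
    by (simp add: ntimes_add algebra_simps)
  also have "\<dots> = 0" by (simp flip: p(2) q(2))
  finally have eq: "- ntimes (m + n) x = p + q" by (metis add.commute minus_unique)
  \<comment> \<open>Otherwise \<open>a\<close> and \<open>- a\<close> would both lie in
    \<open>P\<close> itself.\<close>
  have "m + n \<noteq> 0"
  proof
    assume "m + n = 0"
    then have "p = a" "q = - a" using p q by auto
    then show False using p q P a(3) unfolding positive_cone_def by metis
  qed
  then show ?thesis using eq p q P unfolding positive_cone_def by (metis bot_nat_0.not_eq_extremum)
qed

text \<open>Levi's theorem: a maximal cone is total, because if neither \<open>x\<close> nor \<open>-x\<close> can be adjoined,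
  then it contains \<open>-k x\<close> and \<open>l x\<close> for some positive \<open>k\<close> and \<open>l\<close>.\<close>

lemma torsion_free_imp_group_order:
  assumes tf: "torsion_free TYPE('g::ab_group_add)"
  shows "\<exists>lt :: 'g \<Rightarrow> 'g \<Rightarrow> bool. group_order lt"
proof -
  let ?C = "{P :: 'g set. positive_cone P}"
  have "\<exists>M\<in>?C. \<forall>K\<in>?C. M \<subseteq> K \<longrightarrow> K = M"
  proof (rule subset_Zorn_nonempty)
    have "positive_cone ({0} :: 'g set)" unfolding positive_cone_def by simp
    then show "?C \<noteq> {}" by blast
  next
    fix C assume ne: "C \<noteq> {}" and C: "subset.chain ?C C"
    \<comment> \<open>Every cone axiom involves at most two elements, and two elements of the union
      of a chain lie in a common member.\<close>
    have two: "\<exists>P\<in>C. x \<in> P \<and> y \<in> P" if "x \<in> \<Union>C" "y \<in> \<Union>C" for x y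
      using that C unfolding subset_chain_def by blast
    have cone: "positive_cone P" if "P \<in> C" for P using C that unfolding subset_chain_def by blast
    show "\<Union>C \<in> ?C"
      unfolding mem_Collect_eq positive_cone_def
    proof (intro conjI ballI allI impI)
      show "0 \<in> \<Union>C" using ne cone unfolding positive_cone_def by blast
      show "x + y \<in> \<Union>C" if "x \<in> \<Union>C" "y \<in> \<Union>C" for x y
        using two[OF that] cone unfolding positive_cone_def by blast
      show "x = 0" if "x \<in> \<Union>C \<and> - x \<in> \<Union>C" for x
        using two[of x "- x"] that cone unfolding positive_cone_def by blast
    qed
  qed
  then obtain P :: "'g set" where P: "positive_cone P"
    and max: "\<And>Q. positive_cone Q \<Longrightarrow> P \<subseteq> Q \<Longrightarrow> Q = P" by blast
  have total: "x \<in> P \<or> - x \<in> P" for x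
  proof (rule ccontr)
    assume "\<not> (x \<in> P \<or> - x \<in> P)"
    then obtain k l where k: "k > 0" "- ntimes k x \<in> P" and l: "l > 0" "- ntimes l (- x) \<in> P"
      using maximal_positive_cone_multiple[OF P max] by metis
    \<comment> \<open>Multiplying the two memberships by \<open>l\<close> and by \<open>k\<close>
      yields opposite elements of \<open>P\<close>. Hence \<open>k l x = 0\<close>, and this is
      where torsion-freeness enters.\<close>
    have "- ntimes (k * l) x \<in> P"
      using positive_cone_ntimes[OF P k(2), of l] by (simp add: ntimes_uminus mult.commute flip: ntimes_mult)
    moreover have "ntimes (k * l) x \<in> P"
      using positive_cone_ntimes[OF P l(2), of k] by (simp add: ntimes_uminus ntimes_mult)
    ultimately have "ntimes (k * l) x = 0" using P unfolding positive_cone_def by blast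
    then have "x = 0" using tf k(1) l(1) unfolding torsion_free_iff by (metis nat_0_less_mult_iff)
    then show False using \<open>\<not> (x \<in> P \<or> - x \<in> P)\<close> P unfolding positive_cone_def by blast
  qed
  have "group_order (\<lambda>a b. b - a \<in> P \<and> a \<noteq> b)"
    unfolding group_order_def irreflp_def transp_def totalp_on_def
  proof (intro conjI allI impI ballI)
    show "c - a \<in> P" if "b - a \<in> P \<and> a \<noteq> b" "c - b \<in> P \<and> b \<noteq> c" for a b c
      using that P unfolding positive_cone_def by (metis diff_add_cancel add_diff_eq)
    show "a \<noteq> c" if "b - a \<in> P \<and> a \<noteq> b" "c - b \<in> P \<and> b \<noteq> c" for a b c
      using that P unfolding positive_cone_def
      by (metis minus_diff_eq eq_iff_diff_eq_0)
    show "b - a \<in> P \<and> a \<noteq> b \<or> a - b \<in> P \<and> b \<noteq> a" if "a \<noteq> b" for a b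
      using that total[of "b - a"] by (simp add: eq_commute)
  qed auto
  then show ?thesis by blast
qed

text \<open>If \<open>n = p d\<close> is the least period of \<open>x\<close> and \<open>p\<close>
  is prime, then \<open>y = d x\<close> has exact order \<open>p\<close>, and \<open>H\<close> is
  the set of its multiples. The prime order later selects the coefficient ring of characteristic
  \<open>p\<close>.\<close>

lemma not_torsion_free_imp_finite_subgroup:
  assumes "\<not> torsion_free TYPE('g::ab_group_add)"
  shows "\<exists>H :: 'g set. 0 \<in> H \<and> (\<forall>x\<in>H. \<forall>y\<in>H. x + y \<in> H) \<and> (\<forall>x\<in>H. - x \<in> H) \<and>
    finite H \<and> Factorial_Ring.prime (card H)"
proof -
  obtain x :: 'g and n0 where n0: "n0 > 0" "ntimes n0 x = 0" "x \<noteq> 0"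
    using assms unfolding torsion_free_iff by blast
  define n where "n = (LEAST n. n > 0 \<and> ntimes n x = 0)"
  have n: "n > 0 \<and> ntimes n x = 0" unfolding n_def by (rule LeastI) (use n0 in blast)
  have least: "n \<le> m" if "m > 0" "ntimes m x = 0" for m
    unfolding n_def by (rule Least_le) (use that in blast)
  have "n \<noteq> 1" using n n0(3) by (auto simp: ntimes_Suc)
  then obtain p where p: "Factorial_Ring.prime p" "p dvd n" using prime_factor_nat by blast
  then obtain d where d: "n = p * d" by blast
  define y where "y = ntimes d x"
  have py: "ntimes p y = 0" using n d y_def by (simp add: ntimes_mult)
  have "p > 1" using p(1) prime_gt_1_nat by blast
  \<comment> \<open>A period \<open>k < p\<close> of \<open>y\<close> would make
    \<open>k d < n\<close> a period of \<open>x\<close>.\<close>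
  have y0: "ntimes k y \<noteq> 0" if "0 < k" "k < p" for k
  proof
    assume "ntimes k y = 0"
    then have "ntimes (k * d) x = 0" by (simp add: y_def ntimes_mult)
    moreover have "d > 0" using n d by (cases d) auto
    ultimately show False using least[of "k * d"] that d by auto
  qed
  define H where "H = (\<lambda>i. ntimes i y) ` {..<p}"
  have "inj_on (\<lambda>i. ntimes i y) {..<p}"
  proof (rule linorder_inj_onI)
    fix i j :: nat assume ij: "i < j" "i \<in> {..<p}" "j \<in> {..<p}"
    have "ntimes j y = ntimes i y + ntimes (j - i) y" using ij by (simp flip: ntimes_add)
    then show "ntimes i y \<noteq> ntimes j y" using y0[of "j - i"] ij by auto
  qed auto
  then have card: "card H = p" unfolding H_def by (simp add: card_image)
  have mem: "ntimes i y \<in> H" for i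
  proof -
    have "ntimes i y = ntimes (i div p * p + i mod p) y" by simp
    also have "\<dots> = ntimes (i mod p) y" by (simp only: ntimes_add ntimes_mult py) simp
    finally show ?thesis unfolding H_def using \<open>p > 1\<close> by auto
  qed
  have "a + b \<in> H" if "a \<in> H" "b \<in> H" for a b
    using that mem unfolding H_def by (auto simp flip: ntimes_add)
  moreover have "- a \<in> H" if a: "a \<in> H" for a
  proof -
    obtain i where i: "i < p" "a = ntimes i y" using a unfolding H_def by blast
    then have "a + ntimes (p - i) y = 0" using py by (simp flip: ntimes_add)
    then have "- a = ntimes (p - i) y" by (simp add: minus_unique)
    then show ?thesis using mem by simp
  qed
  moreover have "0 \<in> H" using mem[of 0] by simp
  moreover have "finite H" unfolding H_def by simp
  ultimately show ?thesis using card p(1) by (intro exI[of _ H]) auto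
qed

section \<open>Radicals and prime ideals of commutative rings\<close>

text \<open>Serves two purposes: for \<open>S = {\<one>}\<close> the result is a maximal ideal, and
  for \<open>S\<close> the powers of an element it is a prime ideal that misses this
  element.\<close>

lemma (in ring) Zorn_ideal_avoiding:
  assumes "ideal I R" and "I \<inter> S = {}"
  shows "\<exists>J. ideal J R \<and> I \<subseteq> J \<and> J \<inter> S = {} \<and>
    (\<forall>K. ideal K R \<longrightarrow> J \<subseteq> K \<longrightarrow> K \<inter> S = {} \<longrightarrow> K = J)"
proof -
  let ?C = "{J. ideal J R \<and> I \<subseteq> J \<and> J \<inter> S = {}}"
  have "\<exists>M\<in>?C. \<forall>K\<in>?C. M \<subseteq> K \<longrightarrow> K = M"
  proof (rule subset_Zorn_nonempty)
    show "?C \<noteq> {}" using assms by blast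
  next
    fix C assume ne: "C \<noteq> {}" and C: "subset.chain ?C C"
    then have "subset.chain {J. ideal J R} C" unfolding subset_chain_def by blast
    then have "ideal (if C = {} then {\<zero>} else \<Union>C) R" by (rule chain_Union_is_ideal)
    then have "ideal (\<Union>C) R" using ne by simp
    then show "\<Union>C \<in> ?C" using ne C unfolding subset_chain_def by blast
  qed
  then obtain M where M: "M \<in> ?C" and max: "\<forall>K\<in>?C. M \<subseteq> K \<longrightarrow> K = M" by blast
  show ?thesis
    by (rule exI[of _ M]) (use M max in blast)
qed

lemma (in cring) exists_maximalideal_superset:
  assumes "ideal I R" and "\<one> \<notin> I"
  shows "\<exists>M. maximalideal M R \<and> I \<subseteq> M"
proof -
  obtain M where M: "ideal M R" "I \<subseteq> M" "M \<inter> {\<one>} = {}"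
    and max: "\<And>K. ideal K R \<Longrightarrow> M \<subseteq> K \<Longrightarrow> K \<inter> {\<one>} = {} \<Longrightarrow> K = M"
    using Zorn_ideal_avoiding[of I "{\<one>}"] assms by auto
  have "maximalideal M R"
  proof (rule maximalidealI[OF M(1)])
    show "carrier R \<noteq> M" using M(3) one_closed by blast
    show "J = M \<or> J = carrier R" if "ideal J R" "M \<subseteq> J" "J \<subseteq> carrier R" for J
      using that max ideal.one_imp_carrier[OF that(1)] by blast
  qed
  then show ?thesis using M(2) by blast
qed

lemma (in cring) not_unit_imp_mem_maximalideal:
  assumes "u \<in> carrier R" and "u \<notin> Units R"
  shows "\<exists>M. maximalideal M R \<and> u \<in> M"
proof -
  have "\<one> \<notin> PIdl u"
  proof
    assume "\<one> \<in> PIdl u"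
    then obtain x where "x \<in> carrier R" "\<one> = x \<otimes> u" unfolding cgenideal_def by blast
    then show False using assms m_comm unfolding Units_def by fastforce
  qed
  then show ?thesis
    using exists_maximalideal_superset[OF cgenideal_ideal[OF assms(1)]] cgenideal_self[OF assms(1)] by blast
qed

text \<open>An ideal \<open>P\<close> maximal among those missing the powers of \<open>x\<close> is
  prime: for \<open>a\<close> and \<open>b\<close> outside \<open>P\<close>, both
  \<open>P + (a)\<close> and \<open>P + (b)\<close> contain a power of \<open>x\<close>, and the
  product of these powers would lie in \<open>P\<close> if \<open>a b\<close> did.\<close>

lemma (in cring) not_nilpotent_imp_primeideal:
  assumes x: "x \<in> carrier R" and "x \<notin> nilradical R"
  shows "\<exists>P. primeideal P R \<and> x \<notin> P"
proof -
  define S where "S = {x [^] (k::nat) | k. True}"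
  have "\<zero> \<notin> S" using assms unfolding S_def nilradical_def by auto
  then have "{\<zero>} \<inter> S = {}" by blast
  then obtain P where P: "ideal P R" "P \<inter> S = {}"
    and max: "\<And>K. ideal K R \<Longrightarrow> P \<subseteq> K \<Longrightarrow> K \<inter> S = {} \<Longrightarrow> K = P"
    using Zorn_ideal_avoiding[OF zeroideal, of S] by auto
  interpret P: ideal P R by (rule P(1))
  have key: "\<exists>s\<in>S. \<exists>q\<in>P. \<exists>r\<in>carrier R. s = q \<oplus> r \<otimes> a" if a: "a \<in> carrier R" "a \<notin> P" for a
  proof -
    have K: "ideal (P <+> PIdl a) R" using add_ideals[OF P(1) cgenideal_ideal[OF a(1)]] .
    have el: "z \<in> P <+> PIdl a \<longleftrightarrow> (\<exists>q\<in>P. \<exists>r\<in>carrier R. z = q \<oplus> r \<otimes> a)" for z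
      unfolding set_add_def' cgenideal_def by blast
    have "q = q \<oplus> \<zero> \<otimes> a" if "q \<in> P" for q using that a(1) P.a_Hcarr by simp
    then have "P \<subseteq> P <+> PIdl a" unfolding subset_iff el using zero_closed by blast
    moreover have "a = \<zero> \<oplus> \<one> \<otimes> a" using a(1) by simp
    then have "a \<in> P <+> PIdl a" unfolding el using P.zero_closed one_closed by blast
    ultimately have "(P <+> PIdl a) \<inter> S \<noteq> {}" using max[OF K] a(2) by blast
    then show ?thesis using el by blast
  qed
  have S_mult: "s \<otimes> t \<in> S" if "s \<in> S" "t \<in> S" for s t
    using that unfolding S_def by (auto simp: nat_pow_mult[OF x])
  have "primeideal P R"
  proof (rule primeidealI[OF P(1) is_cring])
    have "\<one> \<in> S" unfolding S_def by (auto intro: exI[of _ "0::nat"])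
    then show "carrier R \<noteq> P" using P(2) one_closed by blast
    show "a \<in> P \<or> b \<in> P" if ab: "a \<in> carrier R" "b \<in> carrier R" "a \<otimes> b \<in> P" for a b
    proof (rule ccontr)
      assume "\<not> (a \<in> P \<or> b \<in> P)"
      then obtain s q r t q' r' where
        s: "s \<in> S" "q \<in> P" "r \<in> carrier R" "s = q \<oplus> r \<otimes> a" and
        t: "t \<in> S" "q' \<in> P" "r' \<in> carrier R" "t = q' \<oplus> r' \<otimes> b"
        using key ab by meson
      have qc: "q \<in> carrier R" "q' \<in> carrier R" using s t P.a_Hcarr by auto
      have tc: "t \<in> carrier R" using t qc ab by simp
      \<comment> \<open>The summands are grouped so that each contains \<open>q\<close>,
        \<open>q'\<close> or \<open>a \<otimes> b\<close>, all of which lie in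
        \<open>P\<close>.\<close>
      have "s \<otimes> t = q \<otimes> t \<oplus> (r \<otimes> a) \<otimes> q' \<oplus> (r \<otimes> r') \<otimes> (a \<otimes> b)"
        using qc ab s t(2,3) tc unfolding s(4)
        by (simp add: t(4) l_distr r_distr a_assoc m_ac)
      also have "\<dots> \<in> P"
        using P.I_r_closed P.I_l_closed s t ab tc qc by (intro P.a_closed) auto
      finally show False using S_mult[OF s(1) t(1)] P(2) by blast
    qed
  qed
  moreover have "x = x [^] (1::nat)" using x by simp
  then have "x \<in> S" unfolding S_def by blast
  ultimately show ?thesis using P(2) by blast
qed

lemma (in primeideal) pow_mem_imp_mem:
  "x \<in> carrier R \<Longrightarrow> x [^] (k::nat) \<in> I \<Longrightarrow> x \<in> I"
proof (induction k)
  case 0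
  then show ?case using one_imp_carrier by simp
next
  case (Suc k)
  then show ?case using I_prime[of "x [^] k" x] by auto
qed

lemma (in cring) nilradical_iff_primeideals:
  "x \<in> nilradical R \<longleftrightarrow> x \<in> carrier R \<and> (\<forall>P. primeideal P R \<longrightarrow> x \<in> P)"
proof
  assume x: "x \<in> nilradical R"
  then obtain k :: nat where k: "x \<in> carrier R" "x [^] k = \<zero>" unfolding nilradical_def by blast
  have "x \<in> P" if "primeideal P R" for P
  proof -
    interpret primeideal P R by (rule that)
    show ?thesis using pow_mem_imp_mem k by (metis zero_closed)
  qed
  then show "x \<in> carrier R \<and> (\<forall>P. primeideal P R \<longrightarrow> x \<in> P)" using k by blast
qed (use not_nilpotent_imp_primeideal in blast)

lemma (in cring) Inter_ideals_is_ideal: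
  assumes "\<And>P. P \<in> C \<Longrightarrow> ideal P R"
  shows "ideal {x \<in> carrier R. \<forall>P\<in>C. x \<in> P} R"
proof -
  \<comment> \<open>Adjoining the carrier keeps the family nonempty. This covers the zero ring,
    which has no prime and no maximal ideals.\<close>
  have "ideal (\<Inter>(insert (carrier R) C)) R"
    by (rule i_Intersect) (use assms oneideal in auto)
  moreover have "\<Inter>(insert (carrier R) C) = {x \<in> carrier R. \<forall>P\<in>C. x \<in> P}" by auto
  ultimately show ?thesis by simp
qed

lemma (in cring) nilradical_is_ideal: "ideal (nilradical R) R"
proof -
  have "nilradical R = {x \<in> carrier R. \<forall>P\<in>{P. primeideal P R}. x \<in> P}"
    using nilradical_iff_primeideals by blast
  then show ?thesis using Inter_ideals_is_ideal[of "{P. primeideal P R}"] primeideal.axioms(1) by auto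
qed

lemma (in cring) jacobson_radical_is_ideal: "ideal (jacobson_radical R) R"
proof -
  have "jacobson_radical R = {x \<in> carrier R. \<forall>P\<in>{P. maximalideal P R}. x \<in> P}"
    unfolding jacobson_radical_def by blast
  then show ?thesis using Inter_ideals_is_ideal[of "{P. maximalideal P R}"] maximalideal.axioms(1) by auto
qed

lemma (in cring) nilradical_subset_jacobson_radical: "nilradical R \<subseteq> jacobson_radical R"
  unfolding jacobson_radical_def using nilradical_iff_primeideals maximalideal_prime by blast

lemma (in cring) one_notin_jacobson_radical:
  assumes "\<one> \<noteq> \<zero>"
  shows "\<one> \<notin> jacobson_radical R"
proof -
  obtain M where "maximalideal M R"
    using exists_maximalideal_superset[OF zeroideal] assms by auto
  then show ?thesis
    unfolding jacobson_radical_def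
    using ideal.one_imp_carrier maximalideal.I_notcarr maximalideal.axioms(1) by fastforce
qed

lemma (in cring) one_notin_nilradical: "\<one> \<noteq> \<zero> \<Longrightarrow> \<one> \<notin> nilradical R"
  unfolding nilradical_def by simp

text \<open>A non-unit \<open>\<one> \<oplus> x\<close> would lie in a maximal ideal, which also
  contains \<open>x\<close> and therefore \<open>\<one>\<close>.\<close>

lemma (in cring) one_plus_jacobson_radical_unit:
  assumes "x \<in> jacobson_radical R"
  shows "\<one> \<oplus> x \<in> Units R"
proof (rule ccontr)
  assume *: "\<one> \<oplus> x \<notin> Units R"
  have x: "x \<in> carrier R" using assms unfolding jacobson_radical_def by blast
  then obtain M where M: "maximalideal M R" "\<one> \<oplus> x \<in> M"
    using not_unit_imp_mem_maximalideal[of "\<one> \<oplus> x"] * by auto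
  interpret M: maximalideal M R by (rule M(1))
  have "x \<in> M" using assms M(1) unfolding jacobson_radical_def by blast
  then have "(\<one> \<oplus> x) \<oplus> \<ominus> x \<in> M"
    by (rule M.a_closed[OF M(2) M.a_inv_closed])
  moreover have "(\<one> \<oplus> x) \<oplus> \<ominus> x = \<one>" using x by (simp add: a_assoc r_neg)
  ultimately show False using M.one_imp_carrier M.I_notcarr by simp
qed

text \<open>The ideals generated by powers of \<open>x\<close> and \<open>1 - x\<close> are comaximal.\<close>

lemma (in cring) eq_zero_of_comaximal_powers:
  assumes x: "x \<in> carrier R" and y: "y \<in> carrier R"
    and "x [^] (k::nat) \<otimes> y = \<zero>" and "(\<one> \<ominus> x) [^] (l::nat) \<otimes> y = \<zero>"
  shows "y = \<zero>"
  using y assms(3,4)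
proof (induction k arbitrary: y)
  case (Suc k)
  \<comment> \<open>This \<open>z\<close> is annihilated by \<open>x\<close>, hence fixed by
    \<open>\<one> \<ominus> x\<close> and by all its powers. The \<open>l\<close>-th of them
    annihilates \<open>y\<close> and so \<open>z\<close>; thus \<open>z = \<zero>\<close>, and the
    exponent of \<open>x\<close> drops by one.\<close>
  define z where "z = x [^] k \<otimes> y"
  have z: "z \<in> carrier R" unfolding z_def using x Suc.prems by simp
  have "x \<otimes> z = \<zero>" unfolding z_def using Suc.prems x by (simp add: m_ac)
  then have 1: "(\<one> \<ominus> x) \<otimes> z = z" using x z by (simp add: a_minus_def l_distr l_minus)
  have "(\<one> \<ominus> x) [^] j \<otimes> z = z" for j :: nat
  proof (induction j)
    case (Suc j)
    then show ?case using 1 x z by (simp add: m_assoc)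
  qed (use z in simp)
  then have "z = (\<one> \<ominus> x) [^] l \<otimes> z" by simp
  also have "\<dots> = x [^] k \<otimes> ((\<one> \<ominus> x) [^] l \<otimes> y)"
    unfolding z_def using Suc.prems(1) x by (simp add: m_ac)
  also have "\<dots> = \<zero>" using Suc.prems x by simp
  finally show ?case using Suc.IH[of y] Suc.prems z_def by simp
qed simp

lemma (in ideal) finsum_mem:
  assumes "finite S" and "\<And>i. i \<in> S \<Longrightarrow> f i \<in> I"
  shows "(\<Oplus>i\<in>S. f i) \<in> I"
  using assms
proof (induction S)
  case (insert i S)
  then have "f \<in> S \<rightarrow> carrier R" "f i \<in> carrier R" using a_Hcarr by auto
  then show ?case using insert a_closed by simp
qed simp

section \<open>Homogeneous components over an ordered group\<close>

context graded_cring
begin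

text \<open>A definite description, hence meaningful only for \<open>f\<close> in the carrier, where
  the decomposition exists and is unique.\<close>

definition cmp :: "'a \<Rightarrow> 'g \<Rightarrow> 'a" where
  "cmp f = (THE c. homogeneous_decomp R A f c)"

lemma component_carrier: "x \<in> A n \<Longrightarrow> x \<in> carrier R"
  using additive_subgroup.a_Hcarr[OF component_subgroup] .

lemma component_zero [simp]: "\<zero> \<in> A n"
  using additive_subgroup.zero_closed[OF component_subgroup] .

lemma component_add: "x \<in> A n \<Longrightarrow> y \<in> A n \<Longrightarrow> x \<oplus> y \<in> A n"
  using additive_subgroup.a_closed[OF component_subgroup] .

lemma component_minus: "x \<in> A n \<Longrightarrow> \<ominus> x \<in> A n"
  using additive_subgroup.a_inv_closed[OF component_subgroup] .

lemma homogeneous_decomp_cmp: "f \<in> carrier R \<Longrightarrow> homogeneous_decomp R A f (cmp f)"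
  unfolding cmp_def by (rule theI'[OF direct_sum])

lemma homogeneous_decomp_imp_cmp:
  "f \<in> carrier R \<Longrightarrow> homogeneous_decomp R A f c \<Longrightarrow> cmp f = c"
  using direct_sum homogeneous_decomp_cmp by blast

lemma cmp_mem: "f \<in> carrier R \<Longrightarrow> cmp f n \<in> A n"
  using homogeneous_decomp_cmp unfolding homogeneous_decomp_def by blast

lemma cmp_closed [simp]: "f \<in> carrier R \<Longrightarrow> cmp f n \<in> carrier R"
  using cmp_mem component_carrier by blast

lemma finite_cmp_support [simp]: "f \<in> carrier R \<Longrightarrow> finite {n. cmp f n \<noteq> \<zero>}"
  using homogeneous_decomp_cmp unfolding homogeneous_decomp_def by blast

lemma eq_finsum_cmp:
  assumes "f \<in> carrier R" and "finite S" and "{n. cmp f n \<noteq> \<zero>} \<subseteq> S"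
  shows "f = (\<Oplus>n\<in>S. cmp f n)"
proof -
  have "f = (\<Oplus>n\<in>{n. cmp f n \<noteq> \<zero>}. cmp f n)"
    using homogeneous_decomp_cmp[OF assms(1)] unfolding homogeneous_decomp_def by blast
  also have "\<dots> = (\<Oplus>n\<in>S. cmp f n)"
    by (rule add.finprod_mono_neutral_cong_left) (use assms in auto)
  finally show ?thesis .
qed

lemma exists_cmp_nonzero:
  assumes "h \<in> carrier R" and "h \<noteq> \<zero>"
  shows "\<exists>n. cmp h n \<notin> {\<zero>}"
proof (rule ccontr)
  assume "\<nexists>n. cmp h n \<notin> {\<zero>}"
  then show False using eq_finsum_cmp[of h "{}"] assms by simp
qed

text \<open>The index set \<open>S\<close> may exceed the support of \<open>c\<close>, so that
  unions and translates of supports can be used directly when components are computed.\<close>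

lemma cmp_eqI:
  assumes "finite S" and c: "\<And>n. c n \<in> A n" and "\<And>n. n \<notin> S \<Longrightarrow> c n = \<zero>"
    and "f = (\<Oplus>n\<in>S. c n)"
  shows "cmp f = c"
proof (rule homogeneous_decomp_imp_cmp)
  have cc: "c n \<in> carrier R" for n using c component_carrier by blast
  show "f \<in> carrier R" unfolding assms(4) by (rule finsum_closed) (use cc in auto)
  have sub: "{n. c n \<noteq> \<zero>} \<subseteq> S" using assms(3) by blast
  have "(\<Oplus>n\<in>{n. c n \<noteq> \<zero>}. c n) = (\<Oplus>n\<in>S. c n)"
    by (rule add.finprod_mono_neutral_cong_left) (use cc sub assms(1) in auto)
  then show "homogeneous_decomp R A f c"
    unfolding homogeneous_decomp_def using assms finite_subset[OF sub] by auto
qed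

lemma cmp_homogeneous:
  assumes "x \<in> A m"
  shows "cmp x = (\<lambda>n. if n = m then x else \<zero>)"
  by (rule cmp_eqI[of "{m}"]) (use assms component_carrier in auto)

lemma cmp_zero [simp]: "cmp \<zero> n = \<zero>"
  using cmp_homogeneous[of \<zero> n] by simp

lemma cmp_add:
  assumes "f \<in> carrier R" and "g \<in> carrier R"
  shows "cmp (f \<oplus> g) n = cmp f n \<oplus> cmp g n"
proof -
  let ?S = "{n. cmp f n \<noteq> \<zero>} \<union> {n. cmp g n \<noteq> \<zero>}"
  have "cmp (f \<oplus> g) = (\<lambda>n. cmp f n \<oplus> cmp g n)"
  proof (rule cmp_eqI[of ?S])
    have "f = (\<Oplus>n\<in>?S. cmp f n)" "g = (\<Oplus>n\<in>?S. cmp g n)"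
      by (rule eq_finsum_cmp; use assms in auto)+
    moreover have "(\<Oplus>n\<in>?S. cmp f n \<oplus> cmp g n) = (\<Oplus>n\<in>?S. cmp f n) \<oplus> (\<Oplus>n\<in>?S. cmp g n)"
      by (rule finsum_addf) (use assms in auto)
    ultimately show "f \<oplus> g = (\<Oplus>n\<in>?S. cmp f n \<oplus> cmp g n)" by simp
  qed (use assms in \<open>auto intro: component_add cmp_mem\<close>)
  then show ?thesis by simp
qed

lemma cmp_minus:
  assumes "f \<in> carrier R"
  shows "cmp (\<ominus> f) n = \<ominus> cmp f n"
proof -
  have "cmp f n \<oplus> cmp (\<ominus> f) n = \<zero>"
    using cmp_add[of f "\<ominus> f" n] assms by (simp add: r_neg)
  then show ?thesis
    using minus_equality[of "cmp (\<ominus> f) n" "cmp f n"] assms by (simp add: a_comm)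
qed

lemma cmp_finsum:
  assumes "finite S" and "f \<in> S \<rightarrow> carrier R"
  shows "cmp (\<Oplus>i\<in>S. f i) n = (\<Oplus>i\<in>S. cmp (f i) n)"
  using assms
proof (induction S)
  case (insert i S)
  then have "f \<in> S \<rightarrow> carrier R" "f i \<in> carrier R" "(\<lambda>i. cmp (f i) n) \<in> S \<rightarrow> carrier R" by (auto simp: Pi_def)
  then show ?case using insert by (simp add: cmp_add)
qed simp

lemma cmp_homogeneous_mult:
  assumes x: "x \<in> A m" and g: "g \<in> carrier R"
  shows "cmp (x \<otimes> g) n = x \<otimes> cmp g (n - m)"
proof -
  let ?T = "{n. cmp g n \<noteq> \<zero>}"
  have xc: "x \<in> carrier R" using x component_carrier by blast
  have "cmp (x \<otimes> g) = (\<lambda>n. x \<otimes> cmp g (n - m))"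
  proof (rule cmp_eqI[of "(+) m ` ?T"])
    show "finite ((+) m ` ?T)" using g by simp
    show "x \<otimes> cmp g (n - m) \<in> A n" for n
      using component_mult[OF x cmp_mem[OF g, of "n - m"]] by simp
    show "x \<otimes> cmp g (n - m) = \<zero>" if "n \<notin> (+) m ` ?T" for n
    proof -
      have "n = m + (n - m)" by simp
      then have "cmp g (n - m) = \<zero>" using that by blast
      then show ?thesis using xc by simp
    qed
    have "x \<otimes> g = x \<otimes> (\<Oplus>n\<in>?T. cmp g n)" using eq_finsum_cmp[of g ?T] g by simp
    also have "\<dots> = (\<Oplus>n\<in>?T. x \<otimes> cmp g n)"
      by (rule finsum_rdistr) (use g xc in auto)
    \<comment> \<open>Written this way, the summand is a function of \<open>m + n\<close>, ready for
      reindexing along the translation by \<open>m\<close>.\<close>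
    also have "\<dots> = (\<Oplus>n\<in>?T. x \<otimes> cmp g ((m + n) - m))" by simp
    also have "\<dots> = (\<Oplus>n\<in>(+) m ` ?T. x \<otimes> cmp g (n - m))"
      by (rule finsum_reindex[symmetric]) (use g xc in auto)
    finally show "x \<otimes> g = (\<Oplus>n\<in>(+) m ` ?T. x \<otimes> cmp g (n - m))" .
  qed
  then show ?thesis by simp
qed

lemma cmp_mult:
  assumes f: "f \<in> carrier R" and g: "g \<in> carrier R"
    and S: "finite S" "{n. cmp f n \<noteq> \<zero>} \<subseteq> S"
  shows "cmp (f \<otimes> g) n = (\<Oplus>i\<in>S. cmp f i \<otimes> cmp g (n - i))"
proof -
  have "f \<otimes> g = (\<Oplus>i\<in>S. cmp f i) \<otimes> g" using eq_finsum_cmp[OF f S] by simp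
  also have "\<dots> = (\<Oplus>i\<in>S. cmp f i \<otimes> g)"
    by (rule finsum_ldistr) (use assms in auto)
  finally have "cmp (f \<otimes> g) n = (\<Oplus>i\<in>S. cmp (cmp f i \<otimes> g) n)"
    using cmp_finsum[of S "\<lambda>i. cmp f i \<otimes> g"] assms by simp
  then show ?thesis using cmp_homogeneous_mult[OF cmp_mem[OF f] g] by simp
qed

text \<open>Let \<open>e\<close> be the component of \<open>\<one>\<close> in degree
  \<open>0\<close>. Comparing components of degree \<open>m\<close> in
  \<open>x \<otimes> \<one> = x\<close> gives \<open>x \<otimes> e = x\<close> for each homogeneous
  \<open>x\<close>. Summing over the components of \<open>\<one>\<close> gives
  \<open>\<one> \<otimes> e = \<one>\<close>.\<close>

lemma one_mem_component: "\<one> \<in> A 0"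
proof -
  let ?S = "{n. cmp \<one> n \<noteq> \<zero>}" and ?e = "cmp \<one> 0"
  have *: "x \<otimes> ?e = x" if "x \<in> A m" for x m
    using cmp_homogeneous_mult[OF that one_closed, of m] cmp_homogeneous[OF that]
      component_carrier[OF that] by simp
  have "?e = \<one> \<otimes> ?e" by simp
  also have "\<dots> = (\<Oplus>n\<in>?S. cmp \<one> n) \<otimes> ?e" using eq_finsum_cmp[of \<one> ?S] by simp
  also have "\<dots> = (\<Oplus>n\<in>?S. cmp \<one> n \<otimes> ?e)" by (rule finsum_ldistr) auto
  also have "\<dots> = (\<Oplus>n\<in>?S. cmp \<one> n)" using *[OF cmp_mem[OF one_closed]] by simp
  also have "\<dots> = \<one>" using eq_finsum_cmp[of \<one> ?S] by simp
  finally show ?thesis using cmp_mem[OF one_closed, of 0] by simp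
qed

lemma cmp_one: "cmp \<one> n = (if n = 0 then \<one> else \<zero>)"
  using cmp_homogeneous[OF one_mem_component] by simp

lemma component_pow: "x \<in> A m \<Longrightarrow> x [^] k \<in> A (ntimes k m)"
proof (induction k)
  case (Suc k)
  then show ?case using component_mult[of "x [^] k" "ntimes k m" x m] by (simp add: ntimes_Suc add.commute)
qed (simp add: one_mem_component)

lemma graded_idealI:
  assumes "ideal I R" and "\<And>f n. f \<in> I \<Longrightarrow> cmp f n \<in> I"
  shows "graded_ideal R A I"
  unfolding graded_ideal_def
proof (intro conjI ballI allI impI)
  fix f c n assume f: "f \<in> I" and "homogeneous_decomp R A f c"
  then have "cmp f = c"
    using homogeneous_decomp_imp_cmp additive_subgroup.a_Hcarr[OF ideal.axioms(1)[OF assms(1)]] by blast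
  then show "c n \<in> I" using assms(2)[OF f] by blast
qed (rule assms(1))

text \<open>Primality is tested on homogeneous elements only. Every prime ideal qualifies, and so
  does the zero ideal of a group ring over a domain, before the group ring is known to be a
  domain.\<close>

definition homogeneous_prime :: "'a set \<Rightarrow> bool" where
  "homogeneous_prime P \<longleftrightarrow> ideal P R \<and>
    (\<forall>m n. \<forall>x\<in>A m. \<forall>y\<in>A n. x \<otimes> y \<in> P \<longrightarrow> x \<in> P \<or> y \<in> P)"

lemma primeideal_imp_homogeneous_prime: "primeideal P R \<Longrightarrow> homogeneous_prime P"
  unfolding homogeneous_prime_def
  by (intro conjI allI ballI impI primeideal.axioms(1) primeideal.I_prime) (auto intro: component_carrier)

text \<open>Let \<open>a\<close> and \<open>b\<close> be the greatest degrees in which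
  \<open>f\<close> and \<open>g\<close> have components outside \<open>P\<close>. In degree
  \<open>a + b\<close> of the product, a term with \<open>i \<noteq> a\<close> and both factors
  outside \<open>P\<close> would have \<open>i\<close> below \<open>a\<close> and
  \<open>a + b - i\<close> at most \<open>b\<close>, which is absurd. So modulo \<open>P\<close>
  only the product of the two leading components remains, and it is outside \<open>P\<close> by
  primality.\<close>

lemma leading_component_mult:
  assumes lt: "group_order (lt :: 'g \<Rightarrow> 'g \<Rightarrow> bool)" and P: "homogeneous_prime P"
    and f: "f \<in> carrier R" "cmp f i \<notin> P" and g: "g \<in> carrier R" "cmp g j \<notin> P"
  obtains a b where "\<And>i. cmp f i \<notin> P \<Longrightarrow> i = a \<or> lt i a" and "\<And>j. cmp g j \<notin> P \<Longrightarrow> j = b \<or> lt j b"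
    and "cmp f a \<notin> P" and "cmp g b \<notin> P" and "cmp (f \<otimes> g) (a + b) \<notin> P"
proof -
  interpret P: ideal P R using P unfolding homogeneous_prime_def by blast
  have prime: "x \<in> P \<or> y \<in> P" if "x \<in> A m" "y \<in> A n" "x \<otimes> y \<in> P" for m n x y
    using P that unfolding homogeneous_prime_def by blast
  have top: "\<exists>a. cmp h a \<notin> P \<and> (\<forall>i. cmp h i \<notin> P \<longrightarrow> i = a \<or> lt i a)"
    if h: "h \<in> carrier R" "cmp h i \<notin> P" for h i
  proof -
    have "{i. cmp h i \<notin> P} \<subseteq> {i. cmp h i \<noteq> \<zero>}" by auto
    then have "finite {i. cmp h i \<notin> P}" using h finite_subset by fastforce
    then show ?thesis using group_order_greatest[OF lt, of "{i. cmp h i \<notin> P}"] h by blast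
  qed
  obtain a where a: "cmp f a \<notin> P" "\<And>i. cmp f i \<notin> P \<Longrightarrow> i = a \<or> lt i a" using top[OF f] by blast
  obtain b where b: "cmp g b \<notin> P" "\<And>i. cmp g i \<notin> P \<Longrightarrow> i = b \<or> lt i b" using top[OF g] by blast
  let ?S = "{n. cmp f n \<noteq> \<zero>}"
  let ?t = "\<lambda>i. cmp f i \<otimes> cmp g (a + b - i)"
  have fin: "finite ?S" using f by simp
  have aS: "a \<in> ?S" using a by auto
  have tc: "?t i \<in> carrier R" for i using f g by simp
  have other: "?t i \<in> P" if "i \<noteq> a" for i
  proof (cases "cmp f i \<in> P \<or> cmp g (a + b - i) \<in> P")
    case True
    then show ?thesis using P.I_l_closed P.I_r_closed f g by auto
  next
    case False
    then have i: "lt i a" using a(2) that by blast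
    have "a + b - i = b \<or> lt (a + b - i) b" using b(2) False by blast
    then have "lt (a + b - i + i) (b + a)" using group_order_add_mono[OF lt _ i] by blast
    then show ?thesis using group_orderD(1)[OF lt] by (simp add: add.commute)
  qed
  have "(\<Oplus>i\<in>insert a (?S - {a}). ?t i) = ?t a \<oplus> (\<Oplus>i\<in>?S - {a}. ?t i)"
    by (rule finsum_insert) (use fin f g in auto)
  moreover have "insert a (?S - {a}) = ?S" using aS by blast
  ultimately have "(\<Oplus>i\<in>?S. ?t i) = ?t a \<oplus> (\<Oplus>i\<in>?S - {a}. ?t i)" by simp
  then have eq: "cmp (f \<otimes> g) (a + b) = cmp f a \<otimes> cmp g b \<oplus> (\<Oplus>i\<in>?S - {a}. ?t i)"
    using cmp_mult[OF f(1) g(1) fin, of "a + b"] by simp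
  have rest: "(\<Oplus>i\<in>?S - {a}. ?t i) \<in> P"
    by (rule P.finsum_mem) (use fin other in auto)
  have "cmp (f \<otimes> g) (a + b) \<notin> P"
  proof
    assume "cmp (f \<otimes> g) (a + b) \<in> P"
    then have "cmp (f \<otimes> g) (a + b) \<ominus> (\<Oplus>i\<in>?S - {a}. ?t i) \<in> P"
      unfolding a_minus_def by (intro P.a_closed P.a_inv_closed rest)
    moreover have "cmp (f \<otimes> g) (a + b) \<ominus> (\<Oplus>i\<in>?S - {a}. ?t i) = cmp f a \<otimes> cmp g b"
      unfolding eq using f g P.a_Hcarr[OF rest] by (simp add: a_minus_def a_assoc r_neg)
    ultimately show False
      using prime[OF cmp_mem[OF f(1)] cmp_mem[OF g(1)], of a b] a(1) b(1) by simp
  qed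
  then show thesis using that a b by blast
qed

lemma homogeneous_prime_mult:
  assumes lt: "group_order (lt :: 'g \<Rightarrow> 'g \<Rightarrow> bool)" and P: "homogeneous_prime P"
    and f: "f \<in> carrier R" "cmp f i \<notin> P" and g: "g \<in> carrier R" "cmp g j \<notin> P"
  shows "\<exists>n. cmp (f \<otimes> g) n \<notin> P"
  by (rule leading_component_mult[OF assms]) (rule exI)

text \<open>The degrees of the leading and of the lowest term of the product agree.\<close>

lemma homogeneous_mult_imp_homogeneous:
  assumes lt: "group_order (lt :: 'g \<Rightarrow> 'g \<Rightarrow> bool)" and P: "homogeneous_prime P"
    and f: "f \<in> carrier R" "cmp f i \<notin> P" "cmp f j \<notin> P" and g: "g \<in> carrier R" "cmp g k \<notin> P"
    and d: "\<And>n. n \<noteq> d \<Longrightarrow> cmp (f \<otimes> g) n \<in> P"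
  shows "i = j"
proof -
  obtain a b where ab: "\<And>i. cmp f i \<notin> P \<Longrightarrow> i = a \<or> lt i a" "\<And>j. cmp g j \<notin> P \<Longrightarrow> j = b \<or> lt j b"
    "cmp f a \<notin> P" "cmp g b \<notin> P" "cmp (f \<otimes> g) (a + b) \<notin> P"
    using leading_component_mult[OF lt P f(1,2) g] by metis
  \<comment> \<open>Leading terms for the reversed order are lowest terms.\<close>
  obtain a' b' where ab': "\<And>i. cmp f i \<notin> P \<Longrightarrow> i = a' \<or> lt a' i" "\<And>j. cmp g j \<notin> P \<Longrightarrow> j = b' \<or> lt b' j"
    "cmp f a' \<notin> P" "cmp g b' \<notin> P" "cmp (f \<otimes> g) (a' + b') \<notin> P"
    using leading_component_mult[OF group_order_dual[OF lt] P f(1,2) g] by metis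
  have "a + b = d" "a' + b' = d" using d ab(5) ab'(5) by blast+
  then have eq: "b' + a' = b + a" by (simp add: add.commute)
  \<comment> \<open>If the degrees \<open>a'\<close> and \<open>a\<close> differed, then
    \<open>a'\<close> would be below \<open>a\<close> while \<open>b'\<close> is at most
    \<open>b\<close>, so \<open>a' + b'\<close> and \<open>a + b\<close> could not both be
    \<open>d\<close>.\<close>
  have "a = a'"
  proof (rule ccontr)
    assume "a \<noteq> a'"
    then have "lt a' a" using ab(1) ab'(3) by blast
    moreover have "b' = b \<or> lt b' b" using ab(2) ab'(4) by blast
    ultimately have "lt (b' + a') (b + a)" using group_order_add_mono[OF lt] by blast
    then show False using eq group_orderD(1)[OF lt] by simp
  qed
  moreover have "x = a" if "cmp f x \<notin> P" for x
    using ab(1)[OF that] ab'(1)[OF that] \<open>a = a'\<close> group_orderD(1,2)[OF lt] by blast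
  ultimately show ?thesis using f by blast
qed

text \<open>If some component of \<open>f\<close> is outside a prime \<open>P\<close>, then every
  power of \<open>f\<close> inherits a component outside \<open>P\<close>, including the power that
  is zero.\<close>

lemma nilradical_graded:
  assumes lt: "group_order (lt :: 'g \<Rightarrow> 'g \<Rightarrow> bool)"
  shows "graded_ideal R A (nilradical R)"
proof (rule graded_idealI[OF nilradical_is_ideal])
  fix f n assume "f \<in> nilradical R"
  then obtain k :: nat where f: "f \<in> carrier R" "f [^] k = \<zero>" unfolding nilradical_def by blast
  have "cmp f n \<in> P" if "primeideal P R" for P
  proof (rule ccontr)
    assume n: "cmp f n \<notin> P"
    interpret P: primeideal P R by (rule that)
    have "\<exists>m. cmp (f [^] j) m \<notin> P" for j :: nat
    proof (induction j)
      case 0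
      then show ?case using P.one_imp_carrier P.I_notcarr cmp_one[of 0] by (intro exI[of _ 0]) auto
    next
      case (Suc j)
      then obtain m where "cmp (f [^] j) m \<notin> P" by blast
      then show ?case
        using homogeneous_prime_mult[OF lt primeideal_imp_homogeneous_prime[OF that] _ _ f(1) n] f by auto
    qed
    from this[of k] show False using f P.zero_closed by simp
  qed
  then show "cmp f n \<in> nilradical R" using nilradical_iff_primeideals f by simp
qed

text \<open>Since \<open>u \<otimes> inv u = \<one>\<close> lives in degree \<open>0\<close>, modulo
  each prime the unit \<open>u\<close> has a single nonzero component. The normalization
  \<open>cmp u 0 = \<one>\<close> forces its degree to be \<open>0\<close>.\<close>

lemma unit_component_nilpotent:
  assumes lt: "group_order (lt :: 'g \<Rightarrow> 'g \<Rightarrow> bool)" and u: "u \<in> Units R" and "cmp u 0 = \<one>" and "n \<noteq> 0"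
  shows "cmp u n \<in> nilradical R"
proof -
  have uc: "u \<in> carrier R" "inv u \<in> carrier R" using u by auto
  have "cmp u n \<in> P" if "primeideal P R" for P
  proof (rule ccontr)
    assume n: "cmp u n \<notin> P"
    interpret P: primeideal P R by (rule that)
    have one: "\<one> \<notin> P" using P.one_imp_carrier P.I_notcarr by blast
    \<comment> \<open>Otherwise \<open>inv u\<close>, the sum of its components, would lie in
      \<open>P\<close>, and with it \<open>\<one>\<close>.\<close>
    have "\<exists>k. cmp (inv u) k \<notin> P"
    proof (rule ccontr)
      let ?S = "{n. cmp (inv u) n \<noteq> \<zero>}"
      assume "\<nexists>k. cmp (inv u) k \<notin> P"
      then have "(\<Oplus>n\<in>?S. cmp (inv u) n) \<in> P" using P.finsum_mem[of ?S "cmp (inv u)"] uc by simp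
      then have "inv u \<in> P" using eq_finsum_cmp[of "inv u" ?S] uc by simp
      then have "u \<otimes> inv u \<in> P" using P.I_l_closed uc by blast
      then show False using one u by simp
    qed
    then obtain k where k: "cmp (inv u) k \<notin> P" by blast
    have "n = 0"
      using homogeneous_mult_imp_homogeneous[OF lt primeideal_imp_homogeneous_prime[OF that] uc(1) n _ uc(2) k, of 0 0]
        assms(3) one u by (simp add: cmp_one)
    then show False using assms(4) by blast
  qed
  then show ?thesis using nilradical_iff_primeideals uc by simp
qed

text \<open>Apply the previous lemma to \<open>1 + f\<^sub>n\<^sup>k f\<close>, where \<open>k\<close> is such that the component of degree \<open>0\<close>
  of \<open>f\<^sub>n\<^sup>k f\<close> vanishes.\<close>

lemma jacobson_radical_component_nilpotent:
  assumes lt: "group_order (lt :: 'g \<Rightarrow> 'g \<Rightarrow> bool)" and fJ: "f \<in> jacobson_radical R" and n: "n \<noteq> 0"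
  shows "cmp f n \<in> nilradical R"
proof (cases "cmp f n = \<zero>")
  case True
  have "\<zero> [^] (1::nat) = \<zero>" by simp
  then show ?thesis unfolding True nilradical_def using zero_closed by blast
next
  case False
  have f: "f \<in> carrier R" using fJ unfolding jacobson_radical_def by blast
  let ?x = "cmp f n"
  \<comment> \<open>The degrees \<open>- k n\<close> are pairwise distinct because \<open>n\<close>
    has infinite order, while \<open>f\<close> has finite support. So the component of
    \<open>f\<close> in one of them vanishes.\<close>
  have "inj (\<lambda>k. - ntimes k n)"
  proof (rule linorder_injI)
    fix i j :: nat assume "i < j"
    then have "ntimes j n = ntimes i n + ntimes (j - i) n" by (simp flip: ntimes_add)
    moreover have "ntimes (j - i) n \<noteq> 0"
      using group_order_imp_torsion_free[OF lt] n \<open>i < j\<close> unfolding torsion_free_iff by (metis zero_less_diff)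
    ultimately show "- ntimes i n \<noteq> - ntimes j n" by simp
  qed
  then have "infinite (range (\<lambda>k. - ntimes k n))" by (rule range_inj_infinite)
  then have "\<not> range (\<lambda>k. - ntimes k n) \<subseteq> {i. cmp f i \<noteq> \<zero>}"
    using finite_subset finite_cmp_support[OF f] by blast
  then obtain k where k: "cmp f (- ntimes k n) = \<zero>" by blast
  have xk: "?x [^] k \<in> A (ntimes k n)" by (rule component_pow) (rule cmp_mem[OF f])
  then have xkc: "?x [^] k \<in> carrier R" by (rule component_carrier)
  let ?u = "\<one> \<oplus> ?x [^] k \<otimes> f"
  have "?x [^] k \<otimes> f \<in> jacobson_radical R"
    using ideal.I_l_closed[OF jacobson_radical_is_ideal fJ xkc] .
  then have unit: "?u \<in> Units R" by (rule one_plus_jacobson_radical_unit)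
  have cmpu: "cmp ?u m = cmp \<one> m \<oplus> ?x [^] k \<otimes> cmp f (m - ntimes k n)" for m
    using cmp_add[of \<one> "?x [^] k \<otimes> f"] cmp_homogeneous_mult[OF xk f] xkc f by simp
  \<comment> \<open>Equality would identify the nonzero component of degree \<open>n\<close> with
    the vanishing one of degree \<open>- k n\<close>.\<close>
  have ne: "n + ntimes k n \<noteq> 0"
  proof
    assume "n + ntimes k n = 0"
    then have "n = - ntimes k n" by (simp add: eq_neg_iff_add_eq_0)
    then show False using k False by simp
  qed
  have "cmp ?u 0 = \<one>" using cmpu[of 0] k xkc by (simp add: cmp_one)
  then have "cmp ?u (n + ntimes k n) \<in> nilradical R"
    using unit_component_nilpotent[OF lt unit _ ne] by blast
  \<comment> \<open>Multiplying by the \<open>k\<close>-th power of \<open>?x\<close> moves degree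
    \<open>n\<close> to \<open>n + k n\<close>, so a power of \<open>?x\<close> itself appears as a
    component of the unit.\<close>
  moreover have "cmp ?u (n + ntimes k n) = ?x [^] Suc k"
    using cmpu[of "n + ntimes k n"] ne xkc f by (simp add: cmp_one)
  ultimately show ?thesis
    unfolding nilradical_iff_primeideals using primeideal.pow_mem_imp_mem f by (metis cmp_closed)
qed

text \<open>Nilpotency settles the nonzero degrees only. The component of degree \<open>0\<close> is
  recovered as the difference of \<open>f\<close> and the sum of the others.\<close>

lemma jacobson_radical_graded:
  assumes lt: "group_order (lt :: 'g \<Rightarrow> 'g \<Rightarrow> bool)"
  shows "graded_ideal R A (jacobson_radical R)"
proof (rule graded_idealI[OF jacobson_radical_is_ideal])
  fix f n assume fJ: "f \<in> jacobson_radical R"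
  interpret J: ideal "jacobson_radical R" R by (rule jacobson_radical_is_ideal)
  have f: "f \<in> carrier R" using fJ J.a_Hcarr by blast
  have ne: "cmp f n \<in> jacobson_radical R" if "n \<noteq> 0" for n
    using jacobson_radical_component_nilpotent[OF lt fJ that] nilradical_subset_jacobson_radical by blast
  let ?S = "{n. cmp f n \<noteq> \<zero>} - {0}"
  let ?r = "\<Oplus>n\<in>?S. cmp f n"
  have "f = (\<Oplus>n\<in>insert 0 ?S. cmp f n)"
    by (rule eq_finsum_cmp) (use f in auto)
  also have "\<dots> = cmp f 0 \<oplus> ?r" by (rule finsum_insert) (use f in auto)
  finally have eq: "f = cmp f 0 \<oplus> ?r" .
  have r: "?r \<in> jacobson_radical R" using J.finsum_mem[of ?S "cmp f"] ne f by simp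
  have "f \<oplus> \<ominus> ?r \<in> jacobson_radical R" by (rule J.a_closed[OF fJ J.a_inv_closed[OF r]])
  moreover have "(cmp f 0 \<oplus> ?r) \<oplus> \<ominus> ?r = cmp f 0"
    using J.a_Hcarr[OF r] f by (simp add: a_assoc r_neg)
  ultimately have "cmp f 0 \<in> jacobson_radical R" using eq by simp
  then show "cmp f n \<in> jacobson_radical R" using ne by (cases "n = 0") auto
qed

end

text \<open>After multiplication by \<open>e\<close> the elements \<open>\<one>\<close> and
  \<open>e\<close> become equal, so \<open>(\<one> \<ominus> x) [^] k \<otimes> e\<close> equals
  \<open>(e \<ominus> x) [^] k \<otimes> e\<close>, which vanishes for large
  \<open>k\<close>.\<close>

lemma (in cring) idempotent_mult_pow_eq_zero:
  assumes e: "e \<in> carrier R" "e \<otimes> e = e" and x: "x \<in> carrier R" and "e \<ominus> x \<in> nilradical R"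
  shows "\<exists>k::nat. (\<one> \<ominus> x) [^] k \<otimes> e = \<zero>"
proof -
  obtain k :: nat where k: "(e \<ominus> x) [^] k = \<zero>" using assms(4) unfolding nilradical_def by blast
  have *: "(\<one> \<ominus> x) \<otimes> e = (e \<ominus> x) \<otimes> e"
    using e x by (simp add: a_minus_def l_distr)
  have "(\<one> \<ominus> x) [^] j \<otimes> e = (e \<ominus> x) [^] j \<otimes> e" for j :: nat
  proof (induction j)
    case (Suc j)
    have "(\<one> \<ominus> x) [^] Suc j \<otimes> e = (\<one> \<ominus> x) [^] j \<otimes> ((\<one> \<ominus> x) \<otimes> e)"
      using e x by (simp add: m_assoc)
    also have "\<dots> = (e \<ominus> x) \<otimes> ((\<one> \<ominus> x) [^] j \<otimes> e)"
      unfolding * using e x by (simp add: m_ac)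
    also have "\<dots> = (e \<ominus> x) [^] Suc j \<otimes> e"
      unfolding Suc using e x by (simp add: m_ac)
    finally show ?case .
  qed simp
  then show ?thesis using k e by (metis l_null)
qed

context graded_cring
begin

text \<open>In a nonzero degree, \<open>e\<close> and \<open>\<one> \<ominus> e\<close> have
  opposite components. If these were outside a prime \<open>P\<close>, the product
  \<open>e \<otimes> (\<one> \<ominus> e) = \<zero>\<close> would have a component outside
  \<open>P\<close>.\<close>

lemma idempotent_component_nilpotent:
  assumes lt: "group_order (lt :: 'g \<Rightarrow> 'g \<Rightarrow> bool)" and e: "e \<in> carrier R" "e \<otimes> e = e" and n: "n \<noteq> 0"
  shows "cmp e n \<in> nilradical R"
proof -
  have eq: "cmp (\<one> \<ominus> e) n = \<ominus> cmp e n"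
    using e n by (simp add: a_minus_def cmp_add cmp_minus cmp_one)
  have z: "e \<otimes> (\<one> \<ominus> e) = \<zero>"
    using e by (simp add: a_minus_def r_distr r_minus r_neg)
  have "cmp e n \<in> P" if "primeideal P R" for P
  proof (rule ccontr)
    assume n: "cmp e n \<notin> P"
    interpret P: primeideal P R by (rule that)
    have "cmp (\<one> \<ominus> e) n \<notin> P"
      using n P.a_inv_closed[of "\<ominus> cmp e n"] e unfolding eq by auto
    then have "\<exists>m. cmp (e \<otimes> (\<one> \<ominus> e)) m \<notin> P"
      using homogeneous_prime_mult[OF lt primeideal_imp_homogeneous_prime[OF that] e(1) n] e by simp
    then show False unfolding z by (simp add: P.zero_closed)
  qed
  then show ?thesis using nilradical_iff_primeideals e by simp
qed

text \<open>Writing \<open>x\<close> for the component of degree \<open>0\<close> of \<open>e\<close>, the difference \<open>e - x\<close> is nilpotent, so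
  \<open>(1 - x)\<^sup>k e = 0\<close> and \<open>x\<^sup>l (1 - e) = 0\<close>; then both powers annihilate every other component of \<open>e\<close>.\<close>

lemma idempotents_subset_component:
  assumes lt: "group_order (lt :: 'g \<Rightarrow> 'g \<Rightarrow> bool)"
  shows "idempotents R \<subseteq> A 0"
proof
  fix e assume "e \<in> idempotents R"
  then have e: "e \<in> carrier R" "e \<otimes> e = e" unfolding idempotents_def by auto
  interpret N: ideal "nilradical R" R by (rule nilradical_is_ideal)
  let ?S = "{n. cmp e n \<noteq> \<zero>} - {0}"
  let ?r = "\<Oplus>n\<in>?S. cmp e n" and ?x = "cmp e 0"
  have "e = (\<Oplus>n\<in>insert 0 ?S. cmp e n)"
    by (rule eq_finsum_cmp) (use e in auto)
  also have "\<dots> = ?x \<oplus> ?r" by (rule finsum_insert) (use e in auto)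
  finally have eq: "e = ?x \<oplus> ?r" .
  have r: "?r \<in> nilradical R"
    using N.finsum_mem[of ?S "cmp e"] idempotent_component_nilpotent[OF lt e] e by simp
  then have rc: "?r \<in> carrier R" using N.a_Hcarr by blast
  have xc: "?x \<in> carrier R" using e by simp
  have "(?x \<oplus> ?r) \<ominus> ?x = ?r"
    using rc xc by (simp add: a_minus_def a_ac r_neg2)
  then have ex: "e \<ominus> ?x = ?r" using eq by simp
  \<comment> \<open>The complementary idempotent has constant term
    \<open>\<one> \<ominus> ?x\<close> and differs from it by \<open>\<ominus> ?r\<close>, so the
    same lemma applies to it.\<close>
  have "(\<one> \<ominus> e) \<ominus> (\<one> \<ominus> ?x) = (\<one> \<oplus> \<ominus> \<one>) \<oplus> \<ominus> (e \<ominus> ?x)"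
    using e xc by (simp add: a_minus_def minus_add a_ac)
  also have "\<dots> = \<ominus> ?r" unfolding ex using rc by (simp add: r_neg)
  finally have ex': "(\<one> \<ominus> e) \<ominus> (\<one> \<ominus> ?x) \<in> nilradical R"
    using N.a_inv_closed[OF r] by simp
  have e': "\<one> \<ominus> e \<in> carrier R" "(\<one> \<ominus> e) \<otimes> (\<one> \<ominus> e) = \<one> \<ominus> e"
    using e by (simp_all add: a_minus_def l_distr r_distr l_minus r_minus r_neg)
  have xx: "\<one> \<ominus> (\<one> \<ominus> ?x) = ?x"
    using xc by (simp add: a_minus_def minus_add r_neg2)
  obtain k :: nat where k: "(\<one> \<ominus> ?x) [^] k \<otimes> e = \<zero>"
    using idempotent_mult_pow_eq_zero[OF e xc] ex r by auto
  obtain l :: nat where l: "?x [^] l \<otimes> (\<one> \<ominus> e) = \<zero>"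
    using idempotent_mult_pow_eq_zero[OF e' _ ex'] xc xx by auto
  have x0: "?x \<in> A 0" using cmp_mem e by blast
  \<comment> \<open>Both annihilating powers have degree \<open>0\<close>. Multiplication by them
    acts on each component separately, so they annihilate the components too.\<close>
  have xl: "?x [^] l \<in> A 0" using component_pow[OF x0] by simp
  have "\<one> \<ominus> ?x \<in> A 0"
    unfolding a_minus_def by (intro component_add component_minus one_mem_component x0)
  then have xk: "(\<one> \<ominus> ?x) [^] k \<in> A 0" using component_pow[of "\<one> \<ominus> ?x" 0] by simp
  have "cmp e n = \<zero>" if n: "n \<noteq> 0" for n
  proof (rule eq_zero_of_comaximal_powers[OF xc])
    show "(\<one> \<ominus> ?x) [^] k \<otimes> cmp e n = \<zero>"
      using cmp_homogeneous_mult[OF xk e(1), of n] k by simp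
    have "?x [^] l \<otimes> cmp (\<one> \<ominus> e) n = \<zero>"
      using cmp_homogeneous_mult[OF xl e'(1), of n] l by simp
    moreover have "cmp (\<one> \<ominus> e) n = \<ominus> cmp e n"
      using e n by (simp add: a_minus_def cmp_add cmp_minus cmp_one)
    ultimately have "\<ominus> (?x [^] l \<otimes> cmp e n) = \<zero>"
      using e xc by (simp add: r_minus)
    then show "?x [^] l \<otimes> cmp e n = \<zero>"
      using e xc by (metis minus_minus minus_zero m_closed nat_pow_closed cmp_closed)
  qed (use e in simp)
  then have "?S = {}" by auto
  then have "e = ?x \<oplus> \<zero>" using eq by (simp only: finsum_empty)
  then show "e \<in> A 0" using x0 xc by simp
qed

section \<open>Zero divisors and units over an ordered group\<close>

lemma no_zero_divisors_if_homogeneous: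
  assumes lt: "group_order (lt :: 'g \<Rightarrow> 'g \<Rightarrow> bool)"
    and hom: "homogeneous_prime {\<zero>}"
    and f: "f \<in> carrier R" and g: "g \<in> carrier R" and fg: "f \<otimes> g = \<zero>"
  shows "f = \<zero> \<or> g = \<zero>"
proof (rule ccontr)
  assume "\<not> (f = \<zero> \<or> g = \<zero>)"
  then obtain i j where "cmp f i \<notin> {\<zero>}" "cmp g j \<notin> {\<zero>}" using exists_cmp_nonzero f g by meson
  then have "\<exists>n. cmp (f \<otimes> g) n \<notin> {\<zero>}"
    using homogeneous_prime_mult[OF lt hom f _ g] by blast
  then show False using fg by simp
qed

lemma units_homogeneous_if_homogeneous:
  assumes lt: "group_order (lt :: 'g \<Rightarrow> 'g \<Rightarrow> bool)"
    and hom: "homogeneous_prime {\<zero>}"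
    and nontriv: "\<one> \<noteq> \<zero>" and u: "u \<in> Units R"
  shows "\<exists>a. u \<in> A a"
proof -
  have uc: "u \<in> carrier R" "inv u \<in> carrier R" using u by auto
  have "u \<noteq> \<zero>" "inv u \<noteq> \<zero>" using nontriv Units_r_inv[OF u] uc by (metis l_null r_null)+
  then obtain i j where i: "cmp u i \<notin> {\<zero>}" and j: "cmp (inv u) j \<notin> {\<zero>}" using exists_cmp_nonzero uc by meson
  have "k = i" if "cmp u k \<noteq> \<zero>" for k
    by (rule homogeneous_mult_imp_homogeneous[OF lt hom uc(1) _ i uc(2) j, of k 0])
      (use that u in \<open>auto simp: cmp_one\<close>)
  then have "u = (\<Oplus>n\<in>{i}. cmp u n)" by (intro eq_finsum_cmp) (use uc in auto)
  then have "u = cmp u i" using uc by simp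
  then show ?thesis using cmp_mem[OF uc(1), of i] by auto
qed

end

section \<open>The group ring as a graded ring\<close>

lemma group_ring_simps:
  "carrier (group_ring T R) = {f. (\<forall>x. f x \<in> carrier R) \<and> finite {x. f x \<noteq> \<zero>\<^bsub>R\<^esub>}}"
  "\<one>\<^bsub>group_ring T R\<^esub> = gmonom R \<one>\<^bsub>R\<^esub> 0"
  "\<zero>\<^bsub>group_ring T R\<^esub> = (\<lambda>x. \<zero>\<^bsub>R\<^esub>)"
  "f \<oplus>\<^bsub>group_ring T R\<^esub> h = (\<lambda>x. f x \<oplus>\<^bsub>R\<^esub> h x)"
  by (simp_all add: group_ring_def)

context cring
begin

abbreviation GR :: "'g::ab_group_add itself \<Rightarrow> ('g \<Rightarrow> 'a) ring" where
  "GR T \<equiv> group_ring T R"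

lemma group_ring_carrierD:
  assumes "f \<in> carrier (GR T)"
  shows "f x \<in> carrier R" and "finite {x. f x \<noteq> \<zero>}"
  using assms by (simp_all add: group_ring_simps)

text \<open>The sum over pairs becomes a convolution in one variable through
  \<open>y = z - x\<close>. Any finite \<open>S\<close> containing the support of \<open>f\<close>
  is allowed, which gives different products a common index set.\<close>

lemma group_ring_mult:
  assumes f: "f \<in> carrier (GR T)" and h: "h \<in> carrier (GR T)"
    and S: "finite S" "{x. f x \<noteq> \<zero>} \<subseteq> S"
  shows "(f \<otimes>\<^bsub>GR T\<^esub> h) z = (\<Oplus>x\<in>S. f x \<otimes> h (z - x))"
proof -
  note fc = group_ring_carrierD(1)[OF f] and hc = group_ring_carrierD(1)[OF h]
  let ?S = "{x\<in>S. f x \<noteq> \<zero> \<and> h (z - x) \<noteq> \<zero>}"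
  have eq: "{(x, y). f x \<noteq> \<zero> \<and> h y \<noteq> \<zero> \<and> x + y = z} = (\<lambda>x. (x, z - x)) ` ?S"
    using S(2) by (auto simp: image_iff)
  have "(f \<otimes>\<^bsub>GR T\<^esub> h) z = (\<Oplus>q\<in>(\<lambda>x. (x, z - x)) ` ?S. f (fst q) \<otimes> h (snd q))"
    by (simp add: group_ring_def flip: eq)
  also have "\<dots> = (\<Oplus>x\<in>?S. f x \<otimes> h (z - x))"
    by (subst finsum_reindex) (use fc hc in \<open>auto intro: inj_onI\<close>)
  also have "\<dots> = (\<Oplus>x\<in>S. f x \<otimes> h (z - x))"
    by (rule add.finprod_mono_neutral_cong_left) (use S(1) fc hc in auto)
  finally show ?thesis .
qed

lemma group_ring_mult_closed:
  assumes f: "f \<in> carrier (GR T)" and h: "h \<in> carrier (GR T)"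
  shows "f \<otimes>\<^bsub>GR T\<^esub> h \<in> carrier (GR T)"
proof -
  let ?S = "{x. f x \<noteq> \<zero>}" and ?T = "{x. h x \<noteq> \<zero>}"
  note fc = group_ring_carrierD[OF f] and hc = group_ring_carrierD[OF h]
  have eq: "(f \<otimes>\<^bsub>GR T\<^esub> h) z = (\<Oplus>x\<in>?S. f x \<otimes> h (z - x))" for z
    using group_ring_mult[OF f h fc(2)] by simp
  have "{z. (f \<otimes>\<^bsub>GR T\<^esub> h) z \<noteq> \<zero>} \<subseteq> (\<lambda>(x, y). x + y) ` (?S \<times> ?T)"
  proof
    fix z assume "z \<in> {z. (f \<otimes>\<^bsub>GR T\<^esub> h) z \<noteq> \<zero>}"
    then have "(\<Oplus>x\<in>?S. f x \<otimes> h (z - x)) \<noteq> \<zero>" using eq by simp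
    then have "\<exists>x\<in>?S. f x \<otimes> h (z - x) \<noteq> \<zero>"
      using add.finprod_one_eqI[of ?S "\<lambda>x. f x \<otimes> h (z - x)"] by auto
    then obtain x where x: "x \<in> ?S" "f x \<otimes> h (z - x) \<noteq> \<zero>" by blast
    then have "z - x \<in> ?T" using fc by auto
    then show "z \<in> (\<lambda>(x, y). x + y) ` (?S \<times> ?T)"
      using x(1) by (intro image_eqI[of _ _ "(x, z - x)"]) auto
  qed
  then have "finite {z. (f \<otimes>\<^bsub>GR T\<^esub> h) z \<noteq> \<zero>}"
    by (rule finite_subset) (use fc(2) hc(2) in simp)
  moreover have "(f \<otimes>\<^bsub>GR T\<^esub> h) z \<in> carrier R" for z
    unfolding eq by (rule finsum_closed) (use fc hc in auto)
  ultimately show ?thesis unfolding group_ring_simps(1) by blast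
qed

lemma group_ring_add_closed:
  assumes f: "f \<in> carrier (GR T)" and h: "h \<in> carrier (GR T)"
  shows "f \<oplus>\<^bsub>GR T\<^esub> h \<in> carrier (GR T)"
proof -
  have "{x. f x \<oplus> h x \<noteq> \<zero>} \<subseteq> {x. f x \<noteq> \<zero>} \<union> {x. h x \<noteq> \<zero>}" by auto
  then have "finite {x. f x \<oplus> h x \<noteq> \<zero>}"
    using group_ring_carrierD(2)[OF f] group_ring_carrierD(2)[OF h] by (meson finite_Un finite_subset)
  then show ?thesis using f h by (simp add: group_ring_simps)
qed

lemma group_ring_minus_closed:
  "f \<in> carrier (GR T) \<Longrightarrow> (\<lambda>x. \<ominus> f x) \<in> carrier (GR T)"
  by (auto simp: group_ring_simps elim!: rev_finite_subset)

lemma gmonom_closed: "r \<in> carrier R \<Longrightarrow> gmonom R r g \<in> carrier (GR T)"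
  by (auto simp: group_ring_simps gmonom_def intro: rev_finite_subset[of "{g}"])

text \<open>Read off from the sum over pairs, which is symmetric under swapping, unlike the
  convolution in one variable.\<close>

lemma group_ring_mult_comm:
  assumes f: "f \<in> carrier (GR T)" and h: "h \<in> carrier (GR T)"
  shows "f \<otimes>\<^bsub>GR T\<^esub> h = h \<otimes>\<^bsub>GR T\<^esub> f"
proof
  fix z
  note fc = group_ring_carrierD(1)[OF f] and hc = group_ring_carrierD(1)[OF h]
  let ?Q = "{(x, y). h x \<noteq> \<zero> \<and> f y \<noteq> \<zero> \<and> x + y = z}"
  have eq: "{(x, y). f x \<noteq> \<zero> \<and> h y \<noteq> \<zero> \<and> x + y = z} = prod.swap ` ?Q"
    by (auto simp: image_iff add.commute)
  have "(f \<otimes>\<^bsub>GR T\<^esub> h) z = (\<Oplus>q\<in>prod.swap ` ?Q. f (fst q) \<otimes> h (snd q))"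
    by (simp add: group_ring_def flip: eq)
  also have "\<dots> = (\<Oplus>q\<in>?Q. f (snd q) \<otimes> h (fst q))"
    by (subst finsum_reindex) (use fc hc in \<open>auto intro: inj_onI\<close>)
  also have "\<dots> = (\<Oplus>q\<in>?Q. h (fst q) \<otimes> f (snd q))"
    by (simp add: m_comm fc hc)
  also have "\<dots> = (h \<otimes>\<^bsub>GR T\<^esub> f) z" by (simp add: group_ring_def)
  finally show "(f \<otimes>\<^bsub>GR T\<^esub> h) z = (h \<otimes>\<^bsub>GR T\<^esub> f) z" .
qed

lemma group_ring_r_distr:
  assumes f: "f \<in> carrier (GR T)" and h: "h \<in> carrier (GR T)" and k: "k \<in> carrier (GR T)"
  shows "k \<otimes>\<^bsub>GR T\<^esub> (f \<oplus>\<^bsub>GR T\<^esub> h) = k \<otimes>\<^bsub>GR T\<^esub> f \<oplus>\<^bsub>GR T\<^esub> k \<otimes>\<^bsub>GR T\<^esub> h"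
proof
  fix z
  let ?S = "{x. k x \<noteq> \<zero>}"
  note fc = group_ring_carrierD[OF f] and hc = group_ring_carrierD[OF h] and kc = group_ring_carrierD[OF k]
  have "(k \<otimes>\<^bsub>GR T\<^esub> (f \<oplus>\<^bsub>GR T\<^esub> h)) z = (\<Oplus>x\<in>?S. k x \<otimes> (f (z - x) \<oplus> h (z - x)))"
    using group_ring_mult[OF k group_ring_add_closed[OF f h] kc(2)] by (simp add: group_ring_simps)
  also have "\<dots> = (\<Oplus>x\<in>?S. k x \<otimes> f (z - x) \<oplus> k x \<otimes> h (z - x))"
    by (simp add: r_distr fc hc kc)
  also have "\<dots> = (\<Oplus>x\<in>?S. k x \<otimes> f (z - x)) \<oplus> (\<Oplus>x\<in>?S. k x \<otimes> h (z - x))"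
    by (rule finsum_addf) (use fc hc kc in auto)
  also have "\<dots> = (k \<otimes>\<^bsub>GR T\<^esub> f \<oplus>\<^bsub>GR T\<^esub> k \<otimes>\<^bsub>GR T\<^esub> h) z"
    using group_ring_mult[OF k f kc(2)] group_ring_mult[OF k h kc(2)] by (simp add: group_ring_simps)
  finally show "(k \<otimes>\<^bsub>GR T\<^esub> (f \<oplus>\<^bsub>GR T\<^esub> h)) z = (k \<otimes>\<^bsub>GR T\<^esub> f \<oplus>\<^bsub>GR T\<^esub> k \<otimes>\<^bsub>GR T\<^esub> h) z" .
qed

lemma group_ring_l_distr:
  assumes f: "f \<in> carrier (GR T)" and h: "h \<in> carrier (GR T)" and k: "k \<in> carrier (GR T)"
  shows "(f \<oplus>\<^bsub>GR T\<^esub> h) \<otimes>\<^bsub>GR T\<^esub> k = f \<otimes>\<^bsub>GR T\<^esub> k \<oplus>\<^bsub>GR T\<^esub> h \<otimes>\<^bsub>GR T\<^esub> k"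
  using group_ring_r_distr[OF assms] group_ring_mult_comm[of k] group_ring_add_closed assms by metis

lemma gmonom_mult_apply:
  assumes r: "r \<in> carrier R" and h: "h \<in> carrier (GR T)"
  shows "(gmonom R r g \<otimes>\<^bsub>GR T\<^esub> h) z = r \<otimes> h (z - g)"
proof -
  have "(gmonom R r g \<otimes>\<^bsub>GR T\<^esub> h) z = (\<Oplus>x\<in>{g}. gmonom R r g x \<otimes> h (z - x))"
    by (rule group_ring_mult[OF gmonom_closed[OF r] h]) (auto simp: gmonom_def)
  then show ?thesis using r group_ring_carrierD(1)[OF h] by (simp add: gmonom_def)
qed

lemma gmonom_mult:
  assumes "r \<in> carrier R" and "s \<in> carrier R"
  shows "gmonom R r g \<otimes>\<^bsub>GR T\<^esub> gmonom R s k = gmonom R (r \<otimes> s) (g + k)"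
proof
  fix z
  have "z - g = k \<longleftrightarrow> z = g + k" by (metis add_diff_cancel_left' diff_add_cancel add.commute)
  then have "r \<otimes> gmonom R s k (z - g) = gmonom R (r \<otimes> s) (g + k) z"
    using assms by (simp add: gmonom_def)
  then show "(gmonom R r g \<otimes>\<^bsub>GR T\<^esub> gmonom R s k) z = gmonom R (r \<otimes> s) (g + k) z"
    by (simp add: gmonom_mult_apply[OF assms(1) gmonom_closed[OF assms(2)]])
qed

text \<open>The support is finite, so monomials can be split off one at a time. This reduces
  identities that are additive in an argument to the case of a monomial.\<close>

lemma group_ring_induct [consumes 1, case_names zero add]:
  assumes "f \<in> carrier (GR T)"
    and zero: "P (\<lambda>x. \<zero>)"
    and add: "\<And>f r g. f \<in> carrier (GR T) \<Longrightarrow> r \<in> carrier R \<Longrightarrow> P f \<Longrightarrow> P (gmonom R r g \<oplus>\<^bsub>GR T\<^esub> f)"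
  shows "P f"
proof -
  have "\<forall>f. f \<in> carrier (GR T) \<longrightarrow> {x. f x \<noteq> \<zero>} = S \<longrightarrow> P f" if "finite S" for S
    using that
  proof (induction S)
    case empty
    show ?case
    proof (intro allI impI)
      fix f assume "f \<in> carrier (GR T)" and "{x. f x \<noteq> \<zero>} = {}"
      then have "f = (\<lambda>x. \<zero>)" by auto
      then show "P f" using zero by simp
    qed
  next
    case (insert g S)
    show ?case
    proof (intro allI impI)
      fix f assume f: "f \<in> carrier (GR T)" and S: "{x. f x \<noteq> \<zero>} = insert g S"
      let ?f = "f(g := \<zero>)"
      have "{x. ?f x \<noteq> \<zero>} = S" using S insert.hyps by auto
      moreover from this have fc: "?f \<in> carrier (GR T)"
        using group_ring_carrierD(1)[OF f] insert.hyps by (simp add: group_ring_simps)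
      ultimately have "P ?f" using insert.IH by blast
      then have "P (gmonom R (f g) g \<oplus>\<^bsub>GR T\<^esub> ?f)"
        using add[OF fc] group_ring_carrierD(1)[OF f] by blast
      moreover have "gmonom R (f g) g \<oplus>\<^bsub>GR T\<^esub> ?f = f"
        using group_ring_carrierD(1)[OF f] by (auto simp: group_ring_simps gmonom_def fun_eq_iff)
      ultimately show "P f" by simp
    qed
  qed
  then show ?thesis using group_ring_carrierD(2)[OF assms(1)] assms(1) by blast
qed

lemma group_ring_zero_closed: "(\<lambda>x. \<zero>) \<in> carrier (GR T)"
  by (simp add: group_ring_simps)

lemma group_ring_l_null: "h \<in> carrier (GR T) \<Longrightarrow> (\<lambda>x. \<zero>) \<otimes>\<^bsub>GR T\<^esub> h = (\<lambda>x. \<zero>)"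
  using group_ring_mult[OF group_ring_zero_closed, of h T "{}"] by (simp add: fun_eq_iff)

lemma group_ring_r_null: "h \<in> carrier (GR T) \<Longrightarrow> h \<otimes>\<^bsub>GR T\<^esub> (\<lambda>x. \<zero>) = (\<lambda>x. \<zero>)"
  by (simp add: group_ring_mult_comm[OF _ group_ring_zero_closed] group_ring_l_null)

text \<open>Both sides are additive in \<open>f\<close> and in \<open>h\<close>, so these may be
  taken to be monomials. Multiplication by a monomial is a scaled translation, and \<open>k\<close>
  can stay arbitrary.\<close>

lemma group_ring_mult_assoc:
  assumes f: "f \<in> carrier (GR T)" and h: "h \<in> carrier (GR T)" and k: "k \<in> carrier (GR T)"
  shows "(f \<otimes>\<^bsub>GR T\<^esub> h) \<otimes>\<^bsub>GR T\<^esub> k = f \<otimes>\<^bsub>GR T\<^esub> (h \<otimes>\<^bsub>GR T\<^esub> k)"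
  using f
proof (induction f rule: group_ring_induct)
  case zero
  then show ?case using h k by (simp add: group_ring_l_null group_ring_mult_closed)
next
  case (add f r g)
  have "(gmonom R r g \<otimes>\<^bsub>GR T\<^esub> h) \<otimes>\<^bsub>GR T\<^esub> k = gmonom R r g \<otimes>\<^bsub>GR T\<^esub> (h \<otimes>\<^bsub>GR T\<^esub> k)"
    using h
  proof (induction h rule: group_ring_induct)
    case zero
    show ?case
      using k gmonom_closed[OF add(2), of g T] by (simp add: group_ring_l_null group_ring_r_null)
  next
    case (add h s l)
    have "(gmonom R r g \<otimes>\<^bsub>GR T\<^esub> gmonom R s l) \<otimes>\<^bsub>GR T\<^esub> k
        = gmonom R r g \<otimes>\<^bsub>GR T\<^esub> (gmonom R s l \<otimes>\<^bsub>GR T\<^esub> k)"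
      using add(2) \<open>r \<in> carrier R\<close> k group_ring_carrierD(1)[OF k]
      by (auto simp: gmonom_mult gmonom_mult_apply fun_eq_iff group_ring_mult_closed gmonom_closed
          m_assoc diff_diff_eq)
    then show ?case
      using add \<open>r \<in> carrier R\<close> k
      by (simp add: group_ring_l_distr group_ring_r_distr gmonom_closed group_ring_mult_closed)
  qed
  then show ?case
    using add h k by (simp add: group_ring_l_distr gmonom_closed group_ring_mult_closed)
qed

lemma group_ring_cring: "cring (GR T)"
proof (rule cringI)
  show "abelian_group (GR T)"
  proof (rule abelian_groupI)
    show "\<exists>y\<in>carrier (GR T). y \<oplus>\<^bsub>GR T\<^esub> x = \<zero>\<^bsub>GR T\<^esub>" if "x \<in> carrier (GR T)" for x
      using group_ring_minus_closed[OF that] group_ring_carrierD(1)[OF that]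
      by (intro bexI[of _ "\<lambda>z. \<ominus> x z"]) (auto simp: group_ring_simps(3,4) l_neg)
  qed (use group_ring_add_closed in \<open>auto simp: group_ring_simps a_ac\<close>)
  show "Group.comm_monoid (GR T)"
  proof (rule comm_monoidI)
    show "\<one>\<^bsub>GR T\<^esub> \<in> carrier (GR T)" by (simp add: group_ring_simps(2) gmonom_closed)
    show "\<one>\<^bsub>GR T\<^esub> \<otimes>\<^bsub>GR T\<^esub> x = x" if "x \<in> carrier (GR T)" for x
      using gmonom_mult_apply[OF one_closed that] group_ring_carrierD(1)[OF that]
      by (auto simp: group_ring_simps(2))
  qed (use group_ring_mult_closed group_ring_mult_assoc group_ring_mult_comm in auto)
qed (rule group_ring_l_distr)

lemma group_ring_finsum_apply:
  assumes "finite S" and "\<And>i. i \<in> S \<Longrightarrow> c i \<in> carrier (GR T)"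
  shows "(\<Oplus>\<^bsub>GR T\<^esub>i\<in>S. c i) x = (\<Oplus>i\<in>S. c i x)"
proof -
  interpret G: cring "GR T" by (rule group_ring_cring)
  show ?thesis
    using assms
  proof (induction S)
    case empty
    then show ?case by (simp add: group_ring_simps(3))
  next
    case (insert i S)
    then have "c \<in> S \<rightarrow> carrier (GR T)" "c i \<in> carrier (GR T)" by auto
    moreover from this have "(\<lambda>i. c i x) \<in> S \<rightarrow> carrier R" "c i x \<in> carrier R"
      using group_ring_carrierD(1) by blast+
    ultimately show ?case using insert by (simp add: group_ring_simps(4))
  qed
qed

lemma gmonom_mem_component: "r \<in> carrier R \<Longrightarrow> gmonom R r g \<in> group_ring_component R g"
  unfolding group_ring_component_def by blast

lemma gmonom_zero: "gmonom R \<zero> g = \<zero>\<^bsub>GR T\<^esub>"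
  by (auto simp: gmonom_def group_ring_simps(3))

lemma group_ring_a_inv: "f \<in> carrier (GR T) \<Longrightarrow> \<ominus>\<^bsub>GR T\<^esub> f = (\<lambda>x. \<ominus> f x)"
proof -
  assume f: "f \<in> carrier (GR T)"
  interpret G: cring "GR T" by (rule group_ring_cring)
  have "(\<lambda>x. \<ominus> f x) \<oplus>\<^bsub>GR T\<^esub> f = \<zero>\<^bsub>GR T\<^esub>"
    using group_ring_carrierD(1)[OF f] by (auto simp: group_ring_simps(3,4) l_neg)
  then show ?thesis using G.minus_equality f group_ring_minus_closed by blast
qed

lemma group_ring_component_eq:
  "group_ring_component R g = {f \<in> carrier (GR T). \<forall>x. x \<noteq> g \<longrightarrow> f x = \<zero>}"
proof (intro subset_antisym subsetI)
  fix f assume "f \<in> {f \<in> carrier (GR T). \<forall>x. x \<noteq> g \<longrightarrow> f x = \<zero>}"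
  then have "f g \<in> carrier R" "f = gmonom R (f g) g"
    using group_ring_carrierD(1) by (auto simp: gmonom_def)
  then show "f \<in> group_ring_component R g" unfolding group_ring_component_def by blast
next
  fix f assume "f \<in> group_ring_component R g"
  then obtain r where "r \<in> carrier R" "f = gmonom R r g" unfolding group_ring_component_def by blast
  then show "f \<in> {f \<in> carrier (GR T). \<forall>x. x \<noteq> g \<longrightarrow> f x = \<zero>}"
    using gmonom_closed by (auto simp: gmonom_def)
qed

text \<open>Evaluating the sum at \<open>n\<close> leaves only the summand of degree
  \<open>n\<close>, so the coefficients of \<open>f\<close> determine \<open>c\<close>. The
  equivalence contains both existence and uniqueness.\<close>

lemma group_ring_homogeneous_decomp_iff:
  assumes f: "f \<in> carrier (GR T)"
  shows "homogeneous_decomp (GR T) (group_ring_component R) f c \<longleftrightarrow> c = (\<lambda>n. gmonom R (f n) n)"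
proof
  note fc = group_ring_carrierD[OF f]
  assume c: "homogeneous_decomp (GR T) (group_ring_component R) f c"
  show "c = (\<lambda>n. gmonom R (f n) n)"
  proof
    fix n
    let ?S = "{n. c n \<noteq> \<zero>\<^bsub>GR T\<^esub>}"
    have mem: "c i \<in> carrier (GR T)" "x \<noteq> i \<Longrightarrow> c i x = \<zero>" for i x
      using c unfolding homogeneous_decomp_def group_ring_component_eq[where T = T] by auto
    have fin: "finite ?S" and eq: "f = (\<Oplus>\<^bsub>GR T\<^esub>n\<in>?S. c n)"
      using c unfolding homogeneous_decomp_def by auto
    note cc = group_ring_carrierD(1)[OF mem(1)]
    have "f n = (\<Oplus>i\<in>?S. c i n)" by (subst eq) (rule group_ring_finsum_apply[OF fin mem(1)])
    \<comment> \<open>Inserting \<open>n\<close> also covers the case in which \<open>c n\<close> is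
      zero.\<close>
    also have "\<dots> = (\<Oplus>i\<in>insert n ?S. c i n)"
      by (rule add.finprod_mono_neutral_cong_left) (use fin cc in \<open>auto simp: group_ring_simps(3)\<close>)
    also have "\<dots> = (\<Oplus>i\<in>{n}. c i n)"
      by (rule add.finprod_mono_neutral_cong_right) (use fin cc mem in auto)
    also have "\<dots> = c n n" using cc by simp
    finally show "c n = gmonom R (f n) n" using mem(2) by (auto simp: gmonom_def)
  qed
next
  note fc = group_ring_carrierD[OF f]
  assume c: "c = (\<lambda>n. gmonom R (f n) n)"
  have S: "{n. c n \<noteq> \<zero>\<^bsub>GR T\<^esub>} = {n. f n \<noteq> \<zero>}"
    by (auto simp: c gmonom_def group_ring_simps(3) fun_eq_iff)
  have "f = (\<Oplus>\<^bsub>GR T\<^esub>n\<in>{n. f n \<noteq> \<zero>}. c n)"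
  proof
    fix x
    have "(\<Oplus>\<^bsub>GR T\<^esub>n\<in>{n. f n \<noteq> \<zero>}. c n) x = (\<Oplus>n\<in>{n. f n \<noteq> \<zero>}. c n x)"
      by (rule group_ring_finsum_apply) (use fc gmonom_closed c in auto)
    also have "\<dots> = (\<Oplus>n\<in>insert x {n. f n \<noteq> \<zero>}. c n x)"
      by (rule add.finprod_mono_neutral_cong_left) (use fc in \<open>auto simp: c gmonom_def\<close>)
    also have "\<dots> = (\<Oplus>n\<in>{x}. c n x)"
      by (rule add.finprod_mono_neutral_cong_right) (use fc in \<open>auto simp: c gmonom_def\<close>)
    also have "\<dots> = f x" using fc by (simp add: c gmonom_def)
    finally show "f x = (\<Oplus>\<^bsub>GR T\<^esub>n\<in>{n. f n \<noteq> \<zero>}. c n) x" by simp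
  qed
  then show "homogeneous_decomp (GR T) (group_ring_component R) f c"
    unfolding homogeneous_decomp_def S using fc c by (simp add: gmonom_mem_component)
qed

lemma group_ring_graded: "graded_cring (GR T) (group_ring_component R)"
proof -
  interpret G: cring "GR T" by (rule group_ring_cring)
  show ?thesis
  proof (intro graded_cring.intro graded_cring_axioms.intro G.is_cring)
    show "additive_subgroup (group_ring_component R n) (GR T)" for n
    proof (intro additive_subgroup.intro G.add.subgroupI)
      show "group_ring_component R n \<subseteq> carrier (GR T)"
        unfolding group_ring_component_eq[where T = T] by blast
      show "group_ring_component R n \<noteq> {}"
        using gmonom_mem_component[OF zero_closed, of n] by auto
      show "\<ominus>\<^bsub>GR T\<^esub> a \<in> group_ring_component R n" if "a \<in> group_ring_component R n" for a
        using that group_ring_minus_closed unfolding group_ring_component_eq[where T = T]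
        by (auto simp: group_ring_a_inv)
      show "a \<oplus>\<^bsub>GR T\<^esub> b \<in> group_ring_component R n"
        if "a \<in> group_ring_component R n" "b \<in> group_ring_component R n" for a b
        using that group_ring_add_closed unfolding group_ring_component_eq[where T = T]
        by (auto simp: group_ring_simps(4))
    qed
    show "x \<otimes>\<^bsub>GR T\<^esub> y \<in> group_ring_component R (m + n)"
      if "x \<in> group_ring_component R m" "y \<in> group_ring_component R n" for x y m n
      using that unfolding group_ring_component_def by (auto simp: gmonom_mult)
    show "\<exists>!c. homogeneous_decomp (GR T) (group_ring_component R) f c" if "f \<in> carrier (GR T)" for f
      by (simp add: group_ring_homogeneous_decomp_iff[OF that])
  qed
qed

end

section \<open>Group rings of ordered groups and of groups with torsion\<close>

lemma (in cring) gmonom_unit: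
  assumes "r \<in> Units R"
  shows "gmonom R r g \<in> Units (GR T)"
proof -
  have r: "r \<in> carrier R" "inv r \<in> carrier R" using assms by auto
  have "gmonom R (inv r) (- g) \<otimes>\<^bsub>GR T\<^esub> gmonom R r g = \<one>\<^bsub>GR T\<^esub>"
    "gmonom R r g \<otimes>\<^bsub>GR T\<^esub> gmonom R (inv r) (- g) = \<one>\<^bsub>GR T\<^esub>"
    using r assms by (simp_all add: gmonom_mult group_ring_simps(2))
  then show ?thesis unfolding Units_def using gmonom_closed r by blast
qed

lemma (in domain) group_ring_zero_homogeneous_prime:
  "graded_cring.homogeneous_prime (GR T) (group_ring_component R) {\<zero>\<^bsub>GR T\<^esub>}"
proof -
  interpret G: graded_cring "GR T" "group_ring_component R" by (rule group_ring_graded)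
  have "x = \<zero>\<^bsub>GR T\<^esub> \<or> y = \<zero>\<^bsub>GR T\<^esub>"
    if x: "x \<in> group_ring_component R m" and y: "y \<in> group_ring_component R n"
      and xy: "x \<otimes>\<^bsub>GR T\<^esub> y = \<zero>\<^bsub>GR T\<^esub>" for x y m n
  proof -
    obtain r s where r: "r \<in> carrier R" "x = gmonom R r m" and s: "s \<in> carrier R" "y = gmonom R s n"
      using x y unfolding group_ring_component_def by blast
    have "(x \<otimes>\<^bsub>GR T\<^esub> y) (m + n) = r \<otimes> s" using r s by (simp add: gmonom_mult) (simp add: gmonom_def)
    then have "r \<otimes> s = \<zero>" using xy by (simp add: group_ring_simps(3))
    then have "r = \<zero> \<or> s = \<zero>" using r s integral by blast
    then show ?thesis unfolding r(2) s(2) using gmonom_zero by metis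
  qed
  then show ?thesis unfolding G.homogeneous_prime_def using G.zeroideal by simp
qed

lemma (in domain) group_ring_one_not_zero:
  "\<one>\<^bsub>GR (T :: 'g::ab_group_add itself)\<^esub> \<noteq> \<zero>\<^bsub>GR T\<^esub>"
proof
  assume "\<one>\<^bsub>GR T\<^esub> = \<zero>\<^bsub>GR T\<^esub>"
  then have "gmonom R \<one> (0::'g) 0 = \<zero>" by (simp add: group_ring_simps(2,3) fun_eq_iff)
  then show False by (simp add: gmonom_def)
qed

lemma (in domain) group_ring_domain:
  assumes "group_order (lt :: 'g::ab_group_add \<Rightarrow> 'g \<Rightarrow> bool)"
  shows "domain (GR TYPE('g))"
proof -
  interpret G: graded_cring "GR TYPE('g)" "group_ring_component R" by (rule group_ring_graded)
  show ?thesis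
    by (intro domainI G.is_cring group_ring_one_not_zero)
      (rule G.no_zero_divisors_if_homogeneous[OF assms group_ring_zero_homogeneous_prime])
qed

lemma (in domain) group_ring_Units:
  assumes "group_order (lt :: 'g::ab_group_add \<Rightarrow> 'g \<Rightarrow> bool)"
  shows "Units (GR TYPE('g)) = {gmonom R r g | r g. r \<in> Units R}"
proof (intro subset_antisym subsetI)
  interpret G: graded_cring "GR TYPE('g)" "group_ring_component R" by (rule group_ring_graded)
  note hom = G.units_homogeneous_if_homogeneous[OF assms group_ring_zero_homogeneous_prime
      group_ring_one_not_zero]
  fix u assume u: "u \<in> Units (GR TYPE('g))"
  let ?v = "inv\<^bsub>GR TYPE('g)\<^esub> u"
  obtain a r where r: "r \<in> carrier R" "u = gmonom R r a"
    using hom[OF u] unfolding group_ring_component_def by blast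
  obtain b s where s: "s \<in> carrier R" "?v = gmonom R s b"
    using hom[OF G.Units_inv_Units[OF u]] unfolding group_ring_component_def by blast
  have "u \<otimes>\<^bsub>GR TYPE('g)\<^esub> ?v = \<one>\<^bsub>GR TYPE('g)\<^esub>" using u by (rule G.Units_r_inv)
  then have "gmonom R (r \<otimes> s) (a + b) = gmonom R \<one> 0"
    unfolding s(2) unfolding r(2) using r s by (simp add: gmonom_mult group_ring_simps(2))
  then have "gmonom R (r \<otimes> s) (a + b) 0 = gmonom R \<one> (0::'g) 0" by simp
  \<comment> \<open>If \<open>a + b\<close> were nonzero, the left-hand side would vanish at
    \<open>0\<close> and give \<open>\<one> = \<zero>\<close>.\<close>
  then have "r \<otimes> s = \<one>" using one_not_zero by (auto simp: gmonom_def split: if_splits)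
  moreover from this have "s \<otimes> r = \<one>" using m_comm[OF r(1) s(1)] by simp
  ultimately have "r \<in> Units R" using r(1) s(1) unfolding Units_def by blast
  then show "u \<in> {gmonom R r g | r g. r \<in> Units R}" using r by blast
qed (use gmonom_unit in auto)

lemma (in domain) idempotents_trivial: "idempotents R \<subseteq> {\<zero>, \<one>}"
proof
  fix e assume "e \<in> idempotents R"
  then have e: "e \<in> carrier R" "e \<otimes> e = e" unfolding idempotents_def by auto
  then have "e \<otimes> e = e \<otimes> \<one>" by simp
  then show "e \<in> {\<zero>, \<one>}" using m_lcancel[of e e \<one>] e by auto
qed

text \<open>An element of square zero lies in both radicals, while in a nonzero ring its component
  \<open>\<one>\<close> lies in neither.\<close>

lemma (in graded_cring) radicals_not_graded:
  assumes f: "f \<in> carrier R" "f \<otimes> f = \<zero>" and c: "homogeneous_decomp R A f c" "c 0 = \<one>"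
    and "\<one> \<noteq> \<zero>"
  shows "\<not> graded_ideal R A (nilradical R)" and "\<not> graded_ideal R A (jacobson_radical R)"
proof -
  have "f [^] (2::nat) = \<zero>" using f by (simp add: numeral_2_eq_2)
  then have "f \<in> nilradical R" using f unfolding nilradical_def by blast
  then have "f \<in> nilradical R" "f \<in> jacobson_radical R" using nilradical_subset_jacobson_radical by auto
  moreover have "c 0 \<notin> nilradical R" "c 0 \<notin> jacobson_radical R"
    using c(2) assms(5) one_notin_nilradical one_notin_jacobson_radical by auto
  ultimately show "\<not> graded_ideal R A (nilradical R)" "\<not> graded_ideal R A (jacobson_radical R)"
    unfolding graded_ideal_def using c(1) by blast+
qed

section \<open>Elements constant on a finite subgroup\<close>

definition add_subgroup :: "'g::ab_group_add set \<Rightarrow> bool" where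
  "add_subgroup H \<longleftrightarrow> 0 \<in> H \<and> (\<forall>x\<in>H. \<forall>y\<in>H. x + y \<in> H) \<and> (\<forall>x\<in>H. - x \<in> H)"

lemma add_subgroup_diff_iff: "add_subgroup H \<Longrightarrow> x \<in> H \<Longrightarrow> z - x \<in> H \<longleftrightarrow> z \<in> H"
  unfolding add_subgroup_def by (metis diff_add_cancel uminus_add_conv_diff add.commute)

context cring
begin

definition const_on :: "'g set \<Rightarrow> 'a \<Rightarrow> 'g \<Rightarrow> 'a" where
  "const_on H r = (\<lambda>x. if x \<in> H then r else \<zero>)"

lemma const_on_closed: "finite H \<Longrightarrow> r \<in> carrier R \<Longrightarrow> const_on H r \<in> carrier (GR T)"
  by (auto simp: group_ring_simps const_on_def intro: rev_finite_subset)

text \<open>For \<open>x \<in> H\<close> the element \<open>z - x\<close> lies in \<open>H\<close>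
  exactly if \<open>z\<close> does, so all \<open>card H\<close> terms of the convolution are equal.
  For \<open>r = s = \<one>\<close> the formula squares the sum of the basis elements of
  \<open>H\<close>.\<close>

lemma const_on_mult:
  assumes H: "add_subgroup H" "finite H" and r: "r \<in> carrier R" and s: "s \<in> carrier R"
  shows "const_on H r \<otimes>\<^bsub>GR T\<^esub> const_on H s = const_on H ([card H] \<cdot> (r \<otimes> s))"
proof
  fix z
  have "(const_on H r \<otimes>\<^bsub>GR T\<^esub> const_on H s) z = (\<Oplus>x\<in>H. const_on H r x \<otimes> const_on H s (z - x))"
    by (rule group_ring_mult[OF const_on_closed[OF H(2) r] const_on_closed[OF H(2) s] H(2)])
      (auto simp: const_on_def)
  also have "\<dots> = (\<Oplus>x\<in>H. if z \<in> H then r \<otimes> s else \<zero>)"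
    by (rule finsum_cong') (use r s add_subgroup_diff_iff[OF H(1)] in \<open>auto simp: const_on_def\<close>)
  also have "\<dots> = const_on H ([card H] \<cdot> (r \<otimes> s)) z"
    using r s by (simp add: const_on_def add.finprod_const)
  finally show "(const_on H r \<otimes>\<^bsub>GR T\<^esub> const_on H s) z = const_on H ([card H] \<cdot> (r \<otimes> s)) z" .
qed

end

context Ring.field
begin

context
  fixes H :: "'g::ab_group_add set" and y :: 'g
  assumes H: "add_subgroup H" "finite H" and y: "y \<in> H" "y \<noteq> 0"
    and char0: "\<And>k::nat. k > 0 \<Longrightarrow> [k] \<cdot> \<one> \<noteq> \<zero>"
begin

text \<open>The scalar \<open>q\<close> is the inverse of \<open>card H\<close>. Neutrality is
  stated for all \<open>t\<close> because it is applied with \<open>t = q\<close> for idempotency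
  and with \<open>t = - q/2\<close> for the inverse of \<open>1 + e\<close>.\<close>

lemma average_over_subgroup:
  obtains q where "q \<in> carrier R" and "[card H] \<cdot> \<one> \<otimes> q = \<one>" and "q \<noteq> \<zero>"
    and "\<And>t. t \<in> carrier R \<Longrightarrow> const_on H q \<otimes>\<^bsub>GR TYPE('g)\<^esub> const_on H t = const_on H t"
proof -
  let ?n = "[card H] \<cdot> \<one>"
  have "card H > 0" using H y card_gt_0_iff by blast
  then have n: "?n \<in> Units R" using char0 field_Units by simp
  then have nc: "?n \<in> carrier R" by simp
  let ?q = "inv ?n"
  have q: "?q \<in> carrier R" "?n \<otimes> ?q = \<one>" using n by auto
  have "[card H] \<cdot> (?q \<otimes> t) = t" if t: "t \<in> carrier R" for t
  proof -
    have "[card H] \<cdot> (?q \<otimes> t) = ?n \<otimes> (?q \<otimes> t)"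
      using add_pow_ldistr[of \<one> "?q \<otimes> t" "card H"] q t by simp
    then show ?thesis using q t nc by (simp flip: m_assoc)
  qed
  then have "const_on H ?q \<otimes>\<^bsub>GR TYPE('g)\<^esub> const_on H t = const_on H t" if "t \<in> carrier R" for t
    using const_on_mult[OF H q(1) that] that by simp
  moreover have "?q \<noteq> \<zero>" using q nc by auto
  ultimately show thesis using that q by blast
qed

text \<open>The support condition permits the passage to a countable ring, and
  \<open>e y \<noteq> \<zero>\<close> with \<open>y \<noteq> 0\<close> keeps \<open>e\<close> out of
  degree \<open>0\<close>.\<close>

lemma idempotent_supported_on_subgroup:
  "\<exists>e \<in> idempotents (GR TYPE('g)). (\<forall>x. x \<notin> H \<longrightarrow> e x = \<zero>) \<and> e y \<noteq> \<zero>"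
proof -
  obtain q where q: "q \<in> carrier R" "q \<noteq> \<zero>"
    "\<And>t. t \<in> carrier R \<Longrightarrow> const_on H q \<otimes>\<^bsub>GR TYPE('g)\<^esub> const_on H t = const_on H t"
    by (rule average_over_subgroup) (rule that)
  have "const_on H q \<in> idempotents (GR TYPE('g))"
    unfolding idempotents_def using q const_on_closed[OF H(2)] by simp
  then show ?thesis using y(1) q(2) by (intro bexI[of _ "const_on H q"]) (auto simp: const_on_def)
qed

lemma nontrivial_idempotent: "\<not> idempotents (GR TYPE('g)) \<subseteq> group_ring_component R 0"
proof
  assume *: "idempotents (GR TYPE('g)) \<subseteq> group_ring_component R 0"
  obtain e where "e \<in> idempotents (GR TYPE('g))" "e y \<noteq> \<zero>"
    using idempotent_supported_on_subgroup by blast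
  then show False using * y(2) unfolding group_ring_component_def gmonom_def by auto
qed

lemma nontrivial_idempotent': "\<not> idempotents (GR TYPE('g)) \<subseteq> {\<zero>\<^bsub>GR TYPE('g)\<^esub>, \<one>\<^bsub>GR TYPE('g)\<^esub>}"
proof -
  have "\<zero>\<^bsub>GR TYPE('g)\<^esub> \<in> group_ring_component R 0" "\<one>\<^bsub>GR TYPE('g)\<^esub> \<in> group_ring_component R 0"
    by (simp_all add: gmonom_mem_component group_ring_simps(2) flip: gmonom_zero[of 0])
  then show ?thesis using nontrivial_idempotent by blast
qed

lemma group_ring_not_domain: "\<not> domain (GR TYPE('g))"
  using nontrivial_idempotent' domain.idempotents_trivial by blast

text \<open>If \<open>e\<close> is idempotent, then \<open>1 + e\<close> is a unit with inverse \<open>1 - e/2\<close>. For \<open>e\<close> the average over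
  \<open>H\<close> it is supported on all of \<open>H\<close>.\<close>

lemma nontrivial_unit: "\<not> Units (GR TYPE('g)) \<subseteq> {gmonom R r g | r g. r \<in> carrier R}"
proof -
  let ?G = "GR TYPE('g)"
  interpret G: cring ?G by (rule group_ring_cring)
  obtain q where q: "q \<in> carrier R" "[card H] \<cdot> \<one> \<otimes> q = \<one>" "q \<noteq> \<zero>"
    "\<And>t. t \<in> carrier R \<Longrightarrow> const_on H q \<otimes>\<^bsub>?G\<^esub> const_on H t = const_on H t"
    by (rule average_over_subgroup) (rule that)
  have two: "\<one> \<oplus> \<one> \<in> Units R"
    using char0[of 2] field_Units by (simp add: numeral_2_eq_2)
  \<comment> \<open>This is \<open>q/2\<close>, so \<open>f\<close> below is \<open>- e/2\<close>.
    Because \<open>e f = f\<close>, the product of \<open>1 + e\<close> and \<open>1 + f\<close> is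
    \<open>1 + (e + 2 f) = 1\<close>.\<close>
  define t where "t = q \<otimes> inv (\<one> \<oplus> \<one>)"
  have t: "t \<in> carrier R" unfolding t_def using q two by simp
  have "t \<oplus> t = q \<otimes> (inv (\<one> \<oplus> \<one>) \<otimes> (\<one> \<oplus> \<one>))"
    unfolding t_def using q two by (simp add: r_distr)
  then have tt: "t \<oplus> t = q" using q two by simp
  have z: "q \<oplus> (\<ominus> t \<oplus> \<ominus> t) = \<zero>"
    using r_neg[OF q(1)] minus_add[OF t t] tt by simp
  define e f where "e = const_on H q" and "f = const_on H (\<ominus> t)"
  have ec: "e \<in> carrier ?G" "f \<in> carrier ?G" unfolding e_def f_def using const_on_closed[OF H(2)] q t by auto
  have ef: "e \<otimes>\<^bsub>?G\<^esub> f = f" unfolding e_def f_def using q t by simp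
  have "e \<oplus>\<^bsub>?G\<^esub> (f \<oplus>\<^bsub>?G\<^esub> f) = \<zero>\<^bsub>?G\<^esub>"
    using z unfolding e_def f_def by (auto simp: group_ring_simps(3,4) const_on_def)
  then have "(\<one>\<^bsub>?G\<^esub> \<oplus>\<^bsub>?G\<^esub> e) \<otimes>\<^bsub>?G\<^esub> (\<one>\<^bsub>?G\<^esub> \<oplus>\<^bsub>?G\<^esub> f) = \<one>\<^bsub>?G\<^esub>"
    using ec ef by (simp add: G.l_distr G.r_distr G.a_assoc)
  moreover from this have "(\<one>\<^bsub>?G\<^esub> \<oplus>\<^bsub>?G\<^esub> f) \<otimes>\<^bsub>?G\<^esub> (\<one>\<^bsub>?G\<^esub> \<oplus>\<^bsub>?G\<^esub> e) = \<one>\<^bsub>?G\<^esub>"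
    using ec G.m_comm[of "\<one>\<^bsub>?G\<^esub> \<oplus>\<^bsub>?G\<^esub> f"] by simp
  moreover have "\<one>\<^bsub>?G\<^esub> \<oplus>\<^bsub>?G\<^esub> e \<in> carrier ?G" "\<one>\<^bsub>?G\<^esub> \<oplus>\<^bsub>?G\<^esub> f \<in> carrier ?G" using ec by simp_all
  ultimately have unit: "\<one>\<^bsub>?G\<^esub> \<oplus>\<^bsub>?G\<^esub> e \<in> Units ?G"
    unfolding Units_def by blast
  have "\<one>\<^bsub>?G\<^esub> \<oplus>\<^bsub>?G\<^esub> e \<noteq> gmonom R r g" for r g
  proof
    assume eq: "\<one>\<^bsub>?G\<^esub> \<oplus>\<^bsub>?G\<^esub> e = gmonom R r g"
    have "gmonom R r g y = q" using y q unfolding eq[symmetric]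
      by (simp add: group_ring_simps(2,4) e_def const_on_def gmonom_def)
    then have "g = y" using q(3) unfolding gmonom_def by metis
    then have "gmonom R r g 0 = \<zero>" using y(2) unfolding gmonom_def by simp
    moreover have "0 \<in> H" using H(1) unfolding add_subgroup_def by blast
    ultimately have z: "\<one> \<oplus> q = \<zero>" unfolding eq[symmetric]
      by (simp add: group_ring_simps(2,4) e_def const_on_def gmonom_def)
    \<comment> \<open>A monomial with value \<open>q\<close> at \<open>y\<close> has value zero at
      \<open>0\<close>, where \<open>1 + e\<close> has the value \<open>\<one> \<oplus> q\<close>.
      Clearing the denominator gives \<open>card H + 1\<close>, nonzero in characteristic
      zero.\<close>
    have "[card H] \<cdot> \<one> \<otimes> (\<one> \<oplus> q) = [Suc (card H)] \<cdot> \<one>"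
      using q by (simp add: r_distr)
    then show False using char0[of "Suc (card H)"] z by simp
  qed
  then show ?thesis using unit by blast
qed

end

end

text \<open>The data of the counterexample in characteristic \<open>card H\<close>, needed both in
  the group ring itself and for its copy inside another type.\<close>

lemma (in cring) group_ring_radicals_not_graded_witness:
  assumes H: "add_subgroup H" "finite H" and p: "[card H] \<cdot> \<one> = \<zero>" and "\<one> \<noteq> \<zero>"
  shows "const_on H \<one> \<otimes>\<^bsub>GR T\<^esub> const_on H \<one> = \<zero>\<^bsub>GR T\<^esub>"
    and "gmonom R (const_on H \<one> 0) 0 = \<one>\<^bsub>GR T\<^esub>" and "\<one>\<^bsub>GR T\<^esub> \<noteq> \<zero>\<^bsub>GR T\<^esub>"
proof -
  show "const_on H \<one> \<otimes>\<^bsub>GR T\<^esub> const_on H \<one> = \<zero>\<^bsub>GR T\<^esub>"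
    using const_on_mult[OF H one_closed one_closed] p by (simp add: const_on_def group_ring_simps(3))
  show "gmonom R (const_on H \<one> 0) 0 = \<one>\<^bsub>GR T\<^esub>"
    using H(1) by (simp add: const_on_def group_ring_simps(2) add_subgroup_def)
  show "\<one>\<^bsub>GR T\<^esub> \<noteq> \<zero>\<^bsub>GR T\<^esub>"
    using assms(4) by (auto simp: group_ring_simps(2,3) gmonom_def fun_eq_iff)
qed

section \<open>Transport of countable graded rings\<close>

text \<open>The carrier enters the definition of a finite sum, so agreement with the sum in the
  subring requires an induction.\<close>

lemma (in ring) finsum_subring:
  assumes "subring C R" and "finite S" and "f \<in> S \<rightarrow> C"
  shows "finsum (R\<lparr>carrier := C\<rparr>) f S = finsum R f S"
proof -
  note C = subringE[OF assms(1)]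
  interpret S: ring "R\<lparr>carrier := C\<rparr>" using subring_iff[OF C(1)] assms(1) by blast
  show ?thesis
    using assms(2,3)
  proof (induction S)
    case empty
    then show ?case using finsum_empty S.finsum_empty by simp
  next
    case (insert x F)
    then have "f \<in> F \<rightarrow> C" "f x \<in> C" by auto
    then have "finsum (R\<lparr>carrier := C\<rparr>) f (insert x F) = f x \<oplus> finsum (R\<lparr>carrier := C\<rparr>) f F"
      using S.finsum_insert[of F x f] insert.hyps by simp
    moreover have "finsum R f (insert x F) = f x \<oplus> finsum R f F"
      by (rule finsum_insert) (use insert C(1) in auto)
    ultimately show ?case using insert \<open>f \<in> F \<rightarrow> C\<close> by simp
  qed
qed

context graded_cring
begin

section \<open>The graded subring of elements supported on a subgroup\<close>

definition supported_on :: "'g set \<Rightarrow> 'a set" where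
  "supported_on H = {f \<in> carrier R. \<forall>n. n \<notin> H \<longrightarrow> cmp f n = \<zero>}"

text \<open>Degrees outside \<open>H\<close> get the zero component, so that the grading is still
  indexed by the whole group.\<close>

definition restrict_component :: "'g set \<Rightarrow> 'g \<Rightarrow> 'a set" where
  "restrict_component H n = (if n \<in> H then A n else {\<zero>})"

lemma restrict_component_subset: "restrict_component H n \<subseteq> A n"
  unfolding restrict_component_def by simp

lemma cmp_supported_on: "f \<in> supported_on H \<Longrightarrow> cmp f n \<in> restrict_component H n"
  unfolding supported_on_def restrict_component_def using cmp_mem by auto

lemma restrict_component_subset_supported_on: "restrict_component H n \<subseteq> supported_on H"
  unfolding restrict_component_def supported_on_def
  using cmp_homogeneous component_carrier by (auto split: if_splits)

lemma supported_on_subring: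
  assumes H: "add_subgroup H"
  shows "subring (supported_on H) R"
proof (rule subringI)
  have H0: "0 \<in> H" using H unfolding add_subgroup_def by blast
  show "supported_on H \<subseteq> carrier R" unfolding supported_on_def by blast
  show "\<one> \<in> supported_on H" unfolding supported_on_def using H0 by (auto simp: cmp_one)
  show "\<ominus> h \<in> supported_on H" if "h \<in> supported_on H" for h
    using that unfolding supported_on_def by (simp add: cmp_minus)
  show "f \<oplus> g \<in> supported_on H" if "f \<in> supported_on H" "g \<in> supported_on H" for f g
    using that unfolding supported_on_def by (simp add: cmp_add)
  show "f \<otimes> g \<in> supported_on H" if "f \<in> supported_on H" "g \<in> supported_on H" for f g
  proof -
    have f: "f \<in> carrier R" "\<And>n. n \<notin> H \<Longrightarrow> cmp f n = \<zero>"
      and g: "g \<in> carrier R" "\<And>n. n \<notin> H \<Longrightarrow> cmp g n = \<zero>"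
      using that unfolding supported_on_def by auto
    have "cmp (f \<otimes> g) n = \<zero>" if n: "n \<notin> H" for n
    proof -
      \<comment> \<open>If \<open>i\<close> and \<open>n - i\<close> both lay in the subgroup
        \<open>H\<close>, so would \<open>n\<close>.\<close>
      have "cmp f i \<otimes> cmp g (n - i) = \<zero>" for i
        using f g n add_subgroup_diff_iff[OF H, of i n] by (cases "i \<in> H") auto
      then show ?thesis using cmp_mult[OF f(1) g(1) finite_cmp_support[OF f(1)]] by simp
    qed
    then show ?thesis using f g unfolding supported_on_def by simp
  qed
qed

lemma homogeneous_decomp_restrict:
  assumes H: "add_subgroup H" and c: "\<And>n. c n \<in> restrict_component H n"
  shows "homogeneous_decomp (R\<lparr>carrier := supported_on H\<rparr>) (restrict_component H) f c \<longleftrightarrow>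
    homogeneous_decomp R A f c"
proof -
  have "finsum (R\<lparr>carrier := supported_on H\<rparr>) c S = finsum R c S" if "finite S" for S
    by (rule finsum_subring[OF supported_on_subring[OF H] that])
      (use c restrict_component_subset_supported_on in blast)
  moreover have "c n \<in> A n" for n using c restrict_component_subset by blast
  ultimately show ?thesis
    unfolding homogeneous_decomp_def using c by auto
qed

lemma graded_cring_restrict:
  assumes H: "add_subgroup H"
  shows "graded_cring (R\<lparr>carrier := supported_on H\<rparr>) (restrict_component H)"
proof -
  let ?S = "R\<lparr>carrier := supported_on H\<rparr>"
  note C = subringE[OF supported_on_subring[OF H]]
  have cring: "cring ?S"
    using subcring_iff[OF C(1)] subcringI'[OF supported_on_subring[OF H]] by blast
  interpret S: cring ?S by (rule cring)
  have minus: "\<ominus>\<^bsub>?S\<^esub> x = \<ominus> x" if "x \<in> supported_on H" for x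
  proof -
    have "\<ominus> x \<oplus> x = \<zero>" using that C(1) by (auto simp: l_neg)
    then show ?thesis using S.minus_equality[of "\<ominus> x" x] that C(5)[OF that] by simp
  qed
  show ?thesis
  proof (intro graded_cring.intro graded_cring_axioms.intro cring)
    show "additive_subgroup (restrict_component H n) ?S" for n
    proof (intro additive_subgroup.intro S.add.subgroupI)
      show "restrict_component H n \<subseteq> carrier ?S" using restrict_component_subset_supported_on by simp
      have "\<zero> \<in> restrict_component H n" unfolding restrict_component_def by simp
      then show "restrict_component H n \<noteq> {}" by blast
      show "\<ominus>\<^bsub>?S\<^esub> a \<in> restrict_component H n" if "a \<in> restrict_component H n" for a
        using that minus restrict_component_subset_supported_on[of H n] component_minus
        unfolding restrict_component_def by (auto split: if_splits)
      show "a \<oplus>\<^bsub>?S\<^esub> b \<in> restrict_component H n"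
        if "a \<in> restrict_component H n" "b \<in> restrict_component H n" for a b
        using that component_add unfolding restrict_component_def by (auto split: if_splits)
    qed
    show "x \<otimes>\<^bsub>?S\<^esub> y \<in> restrict_component H (m + n)"
      if "x \<in> restrict_component H m" "y \<in> restrict_component H n" for x y m n
    proof (cases "m \<in> H \<and> n \<in> H")
      case True
      then have "m + n \<in> H" using H unfolding add_subgroup_def by blast
      then show ?thesis using True that component_mult unfolding restrict_component_def by simp
    next
      case False
      then have "x \<otimes> y = \<zero>"
        using that component_carrier unfolding restrict_component_def by (auto split: if_splits)
      then show ?thesis unfolding restrict_component_def by simp
    qed
    show "\<exists>!c. homogeneous_decomp ?S (restrict_component H) f c" if "f \<in> carrier ?S" for f
    proof -
      have f: "f \<in> supported_on H" "f \<in> carrier R" using that C(1) by auto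
      show ?thesis
      proof (rule ex1I[of _ "cmp f"])
        show "homogeneous_decomp ?S (restrict_component H) f (cmp f)"
          using homogeneous_decomp_restrict[OF H] cmp_supported_on[OF f(1)] homogeneous_decomp_cmp[OF f(2)]
          by blast
        fix c assume c: "homogeneous_decomp ?S (restrict_component H) f c"
        then have "\<And>n. c n \<in> restrict_component H n" unfolding homogeneous_decomp_def by blast
        then have "homogeneous_decomp R A f c" using homogeneous_decomp_restrict[OF H] c by blast
        then show "c = cmp f" using homogeneous_decomp_imp_cmp f(2) by blast
      qed
    qed
  qed
qed

end

text \<open>Injectivity on the carrier preserves and reflects zero components, and a ring
  homomorphism commutes with the finite sums.\<close>

lemma homogeneous_decomp_image_iff:
  assumes "graded_cring R A" and \<phi>: "inj_on \<phi> (carrier R)" and c: "\<And>n. c n \<in> A n"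
    and f: "f \<in> carrier R"
  shows "homogeneous_decomp (image_ring \<phi> R) (\<lambda>n. \<phi> ` A n) (\<phi> f) (\<lambda>n. \<phi> (c n)) \<longleftrightarrow>
    homogeneous_decomp R A f c"
proof -
  interpret graded_cring R A by fact
  interpret I: cring "image_ring \<phi> R"
    using ring_iso_imp_img_cring[OF inj_imp_image_ring_iso[OF \<phi>]]
    by (simp add: image_ring_def image_group_def monoid.defs)
  have hom: "\<phi> \<in> ring_hom R (image_ring \<phi> R)"
    using inj_imp_image_ring_iso[OF \<phi>] unfolding ring_iso_def by blast
  interpret h: ring_hom_cring R "image_ring \<phi> R" \<phi>
    by (intro ring_hom_cring.intro ring_hom_cring_axioms.intro is_cring I.is_cring hom)
  have cc: "c n \<in> carrier R" for n using c component_carrier by blast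
  have supp: "{n. \<phi> (c n) \<noteq> \<zero>\<^bsub>image_ring \<phi> R\<^esub>} = {n. c n \<noteq> \<zero>\<^bsub>R\<^esub>}"
    by (simp only: image_ring_zero inj_on_eq_iff[OF \<phi> cc zero_closed])
  have "\<phi> f = (\<Oplus>\<^bsub>image_ring \<phi> R\<^esub>n\<in>S. \<phi> (c n)) \<longleftrightarrow> f = (\<Oplus>\<^bsub>R\<^esub>n\<in>S. c n)" for S
  proof -
    have "\<phi> (\<Oplus>\<^bsub>R\<^esub>n\<in>S. c n) = (\<Oplus>\<^bsub>image_ring \<phi> R\<^esub>n\<in>S. \<phi> (c n))"
      using h.hom_finsum[of c S] cc by (simp add: comp_def)
    moreover have "(\<Oplus>\<^bsub>R\<^esub>n\<in>S. c n) \<in> carrier R" by (rule finsum_closed) (use cc in auto)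
    ultimately show ?thesis using inj_on_eq_iff[OF \<phi> f, of "\<Oplus>\<^bsub>R\<^esub>n\<in>S. c n"] by simp
  qed
  then show ?thesis unfolding homogeneous_decomp_def supp using c by auto
qed

lemma graded_cring_image:
  assumes "graded_cring R A" and \<phi>: "inj_on \<phi> (carrier R)"
  shows "graded_cring (image_ring \<phi> R) (\<lambda>n. \<phi> ` A n)"
proof -
  interpret graded_cring R A by fact
  interpret I: cring "image_ring \<phi> R"
    using ring_iso_imp_img_cring[OF inj_imp_image_ring_iso[OF \<phi>]]
    by (simp add: image_ring_def image_group_def monoid.defs)
  have hom: "\<phi> \<in> ring_hom R (image_ring \<phi> R)"
    using inj_imp_image_ring_iso[OF \<phi>] unfolding ring_iso_def by blast
  interpret h: ring_hom_cring R "image_ring \<phi> R" \<phi>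
    by (intro ring_hom_cring.intro ring_hom_cring_axioms.intro is_cring I.is_cring hom)
  show ?thesis
  proof (intro graded_cring.intro graded_cring_axioms.intro I.is_cring)
    show "additive_subgroup (\<phi> ` A n) (image_ring \<phi> R)" for n
    proof (intro additive_subgroup.intro I.add.subgroupI)
      show "\<phi> ` A n \<subseteq> carrier (image_ring \<phi> R)"
        using component_carrier by (auto simp: image_ring_carrier)
      show "\<phi> ` A n \<noteq> {}" using component_zero by blast
      show "\<ominus>\<^bsub>image_ring \<phi> R\<^esub> a \<in> \<phi> ` A n" if "a \<in> \<phi> ` A n" for a
      proof -
        from that obtain x where x: "x \<in> A n" "a = \<phi> x" by blast
        then have "\<ominus>\<^bsub>image_ring \<phi> R\<^esub> a = \<phi> (\<ominus>\<^bsub>R\<^esub> x)" using component_carrier by simp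
        then show ?thesis using component_minus[OF x(1)] by simp
      qed
      show "a \<oplus>\<^bsub>image_ring \<phi> R\<^esub> b \<in> \<phi> ` A n" if ab: "a \<in> \<phi> ` A n" "b \<in> \<phi> ` A n" for a b
      proof -
        obtain x y where x: "x \<in> A n" "a = \<phi> x" "y \<in> A n" "b = \<phi> y" using ab by blast
        then have "a \<oplus>\<^bsub>image_ring \<phi> R\<^esub> b = \<phi> (x \<oplus>\<^bsub>R\<^esub> y)" using component_carrier by simp
        then show ?thesis using component_add[OF x(1,3)] by simp
      qed
    qed
    show "a \<otimes>\<^bsub>image_ring \<phi> R\<^esub> b \<in> \<phi> ` A (m + n)"
      if ab: "a \<in> \<phi> ` A m" "b \<in> \<phi> ` A n" for a b m n
    proof -
      obtain x y where x: "x \<in> A m" "a = \<phi> x" "y \<in> A n" "b = \<phi> y" using ab by blast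
      then have "a \<otimes>\<^bsub>image_ring \<phi> R\<^esub> b = \<phi> (x \<otimes>\<^bsub>R\<^esub> y)" using component_carrier by simp
      then show ?thesis using component_mult[OF x(1,3)] by simp
    qed
    show "\<exists>!c. homogeneous_decomp (image_ring \<phi> R) (\<lambda>n. \<phi> ` A n) a c"
      if a: "a \<in> carrier (image_ring \<phi> R)" for a
    proof -
      obtain f where f: "f \<in> carrier R" "a = \<phi> f" using a unfolding image_ring_carrier by blast
      note iff = homogeneous_decomp_image_iff[OF assms _ f(1)]
      show ?thesis
      proof (rule ex1I[of _ "\<lambda>n. \<phi> (cmp f n)"])
        show "homogeneous_decomp (image_ring \<phi> R) (\<lambda>n. \<phi> ` A n) a (\<lambda>n. \<phi> (cmp f n))"
          unfolding f(2) using iff[of "cmp f"] cmp_mem[OF f(1)] homogeneous_decomp_cmp[OF f(1)] by blast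
        fix d assume d: "homogeneous_decomp (image_ring \<phi> R) (\<lambda>n. \<phi> ` A n) a d"
        then have "\<forall>n. \<exists>x\<in>A n. d n = \<phi> x" unfolding homogeneous_decomp_def by blast
        then obtain c where c: "\<And>n. c n \<in> A n" "\<And>n. d n = \<phi> (c n)" by metis
        then have dc: "d = (\<lambda>n. \<phi> (c n))" by blast
        have "homogeneous_decomp R A f c" using d iff[of c] c(1) unfolding dc f(2) by blast
        then show "d = (\<lambda>n. \<phi> (cmp f n))" using homogeneous_decomp_imp_cmp[OF f(1)] dc by blast
      qed
    qed
  qed
qed

lemma countable_imp_inj_on_infinite:
  assumes "countable C" and "infinite (UNIV :: 'r set)"
  shows "\<exists>\<phi> :: 'a \<Rightarrow> 'r. inj_on \<phi> C"
proof -
  obtain g :: "nat \<Rightarrow> 'r" where "inj g" using assms(2) infinite_countable_subset by blast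
  then have "inj_on (g \<circ> to_nat_on C) C"
    using inj_on_to_nat_on[OF assms(1)] by (intro comp_inj_on) (auto intro: inj_on_subset)
  then show ?thesis by blast
qed

lemma (in cring) group_ring_cmp:
  assumes "f \<in> carrier (GR T)"
  shows "graded_cring.cmp (GR T) (group_ring_component R) f = (\<lambda>n. gmonom R (f n) n)"
  using graded_cring.homogeneous_decomp_imp_cmp[OF group_ring_graded assms]
    group_ring_homogeneous_decomp_iff[OF assms] by blast

lemma (in cring) group_ring_supported_on:
  "graded_cring.supported_on (GR T) (group_ring_component R) H =
    {f \<in> carrier (GR T). \<forall>n. n \<notin> H \<longrightarrow> f n = \<zero>}"
proof -
  have "gmonom R r n = \<zero>\<^bsub>GR T\<^esub> \<longleftrightarrow> r = \<zero>" for r n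
    by (auto simp: gmonom_def group_ring_simps(3) fun_eq_iff)
  then show ?thesis
    unfolding graded_cring.supported_on_def[OF group_ring_graded] by (auto simp: group_ring_cmp)
qed

text \<open>A function supported on \<open>insert h H\<close> is determined by its value at
  \<open>h\<close> and by the function obtained from it by resetting that value to
  \<open>z\<close>.\<close>

lemma countable_functions_finite_support:
  assumes "countable K" and "finite H" and "z \<in> K"
  shows "countable {f. (\<forall>x. f x \<in> K) \<and> (\<forall>x. x \<notin> H \<longrightarrow> f x = z)}"
  using assms(2)
proof (induction H)
  case empty
  have "{f. (\<forall>x. f x \<in> K) \<and> (\<forall>x. x \<notin> {} \<longrightarrow> f x = z)} \<subseteq> {\<lambda>x. z}" by auto
  then show ?case by (rule countable_subset) simp
next
  case (insert h H)
  let ?F = "\<lambda>H. {f. (\<forall>x. f x \<in> K) \<and> (\<forall>x. x \<notin> H \<longrightarrow> f x = z)}"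
  have "?F (insert h H) \<subseteq> (\<lambda>(r, f). f(h := r)) ` (K \<times> ?F H)"
  proof
    fix f assume f: "f \<in> ?F (insert h H)"
    show "f \<in> (\<lambda>(r, f). f(h := r)) ` (K \<times> ?F H)"
      by (rule image_eqI[of _ _ "(f h, f(h := z))"]) (use f assms(3) in auto)
  qed
  then show ?case by (rule countable_subset) (use insert assms in auto)
qed

lemma (in cring) countable_group_ring_supported_on:
  assumes "countable (carrier R)" and "finite H"
  shows "countable (graded_cring.supported_on (GR T) (group_ring_component R) H)"
proof -
  have "graded_cring.supported_on (GR T) (group_ring_component R) H
      \<subseteq> {f. (\<forall>x. f x \<in> carrier R) \<and> (\<forall>x. x \<notin> H \<longrightarrow> f x = \<zero>)}"
    unfolding group_ring_supported_on by (auto dest: group_ring_carrierD(1))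
  then show ?thesis
    using countable_functions_finite_support[OF assms zero_closed] by (rule countable_subset)
qed

text \<open>An element of a group ring over a countable ring that is supported on a finite subgroup lives
  in a countable graded ring, of which every infinite type carries a copy.\<close>

lemma (in cring) transport_supported_on:
  assumes R: "countable (carrier R)" and H: "add_subgroup H" "finite (H :: 'g::ab_group_add set)"
    and inf: "infinite (UNIV :: 'r set)"
    and f: "f \<in> carrier (GR TYPE('g))" "\<And>n. n \<notin> H \<Longrightarrow> f n = \<zero>"
  shows "\<exists>(S :: 'r ring) B \<phi> C. graded_cring S B \<and> \<phi> \<in> ring_hom ((GR TYPE('g))\<lparr>carrier := C\<rparr>) S \<and>
    inj_on \<phi> C \<and> f \<in> C \<and> subring C (GR TYPE('g)) \<and>
    (\<forall>n. gmonom R (f n) n \<in> C) \<and> homogeneous_decomp S B (\<phi> f) (\<lambda>n. \<phi> (gmonom R (f n) n))"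
proof -
  interpret G: graded_cring "GR TYPE('g)" "group_ring_component R" by (rule group_ring_graded)
  let ?C = "G.supported_on H" and ?A = "G.restrict_component H"
  let ?S = "(GR TYPE('g))\<lparr>carrier := ?C\<rparr>"
  have S: "graded_cring ?S ?A" by (rule G.graded_cring_restrict[OF H(1)])
  obtain \<phi> :: "('g \<Rightarrow> 'a) \<Rightarrow> 'r" where \<phi>: "inj_on \<phi> ?C"
    using countable_imp_inj_on_infinite[OF countable_group_ring_supported_on[OF R H(2)] inf] by blast
  then have \<phi>': "inj_on \<phi> (carrier ?S)" by simp
  have fC: "f \<in> ?C" using f unfolding group_ring_supported_on by blast
  have c: "G.cmp f n \<in> ?A n" for n using G.cmp_supported_on[OF fC] .
  have "homogeneous_decomp ?S ?A f (G.cmp f)"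
    using G.homogeneous_decomp_restrict[OF H(1) c] G.homogeneous_decomp_cmp[OF f(1)] by blast
  then have "homogeneous_decomp (image_ring \<phi> ?S) (\<lambda>n. \<phi> ` ?A n) (\<phi> f) (\<lambda>n. \<phi> (G.cmp f n))"
    using homogeneous_decomp_image_iff[OF S \<phi>' c] fC by simp
  then have "homogeneous_decomp (image_ring \<phi> ?S) (\<lambda>n. \<phi> ` ?A n) (\<phi> f) (\<lambda>n. \<phi> (gmonom R (f n) n))"
    using group_ring_cmp[OF f(1)] by simp
  moreover have "gmonom R (f n) n \<in> ?C" for n
    using c[of n] G.restrict_component_subset_supported_on[of H n] by (auto simp: group_ring_cmp[OF f(1)])
  moreover have "\<phi> \<in> ring_hom ?S (image_ring \<phi> ?S)"
    using inj_imp_image_ring_iso[OF \<phi>'] unfolding ring_iso_def by blast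
  ultimately show ?thesis
    using graded_cring_image[OF S \<phi>'] \<phi> fC G.supported_on_subring[OF H(1)] by blast
qed

section \<open>The equivalences\<close>

lemma rat_ring_simps:
  "carrier rat_ring = UNIV" "x \<otimes>\<^bsub>rat_ring\<^esub> y = x * y" "\<one>\<^bsub>rat_ring\<^esub> = 1"
  "\<zero>\<^bsub>rat_ring\<^esub> = 0" "x \<oplus>\<^bsub>rat_ring\<^esub> y = x + y"
  by (simp_all add: ring_of_type_algebra_def)

lemma rat_ring_Units: "Units rat_ring = {r. r \<noteq> 0}"
proof -
  interpret Ring.field rat_ring by (rule field_from_type_algebra)
  show ?thesis using field_Units by (auto simp: rat_ring_simps)
qed

lemma rat_ring_char0:
  assumes "k > 0"
  shows "[(k::nat)] \<cdot>\<^bsub>rat_ring\<^esub> \<one>\<^bsub>rat_ring\<^esub> \<noteq> \<zero>\<^bsub>rat_ring\<^esub>"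
proof -
  interpret Ring.field rat_ring by (rule field_from_type_algebra)
  have "[k] \<cdot>\<^bsub>rat_ring\<^esub> \<one>\<^bsub>rat_ring\<^esub> = of_nat k" for k :: nat
    by (induction k) (simp_all add: rat_ring_simps add.commute)
  then show ?thesis using assms by (simp add: rat_ring_simps)
qed

text \<open>A copy of the rationals inside \<open>'r\<close>: the assertions on arbitrary
  coefficient rings range over rings in this type, and \<open>rat_ring\<close> lives in another
  one.\<close>

lemma exists_char0_field:
  assumes "infinite (UNIV :: 'r set)"
  shows "\<exists>K :: 'r ring. Ring.field K \<and> (\<forall>k::nat. k > 0 \<longrightarrow> [k] \<cdot>\<^bsub>K\<^esub> \<one>\<^bsub>K\<^esub> \<noteq> \<zero>\<^bsub>K\<^esub>)"
proof -
  interpret Q: Ring.field rat_ring by (rule field_from_type_algebra)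
  obtain \<phi> :: "rat \<Rightarrow> 'r" where \<phi>: "inj_on \<phi> (carrier rat_ring)"
    using countable_imp_inj_on_infinite[OF _ assms, of "carrier rat_ring"] by auto
  let ?K = "image_ring \<phi> rat_ring"
  interpret K: Ring.field ?K by (rule Q.inj_imp_image_ring_is_field[OF \<phi>])
  have hom: "\<phi> \<in> ring_hom rat_ring ?K"
    using inj_imp_image_ring_iso[OF \<phi>] unfolding ring_iso_def by blast
  have "[k] \<cdot>\<^bsub>?K\<^esub> \<one>\<^bsub>?K\<^esub> = \<phi> ([k] \<cdot>\<^bsub>rat_ring\<^esub> \<one>\<^bsub>rat_ring\<^esub>)" for k :: nat
  proof (induction k)
    case (Suc k)
    then show ?case
      using ring_hom_add[OF hom, of "[k] \<cdot>\<^bsub>rat_ring\<^esub> \<one>\<^bsub>rat_ring\<^esub>" "\<one>\<^bsub>rat_ring\<^esub>"] by (simp add: image_ring_one)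
  qed (simp add: image_ring_zero)
  then have "[k] \<cdot>\<^bsub>?K\<^esub> \<one>\<^bsub>?K\<^esub> \<noteq> \<zero>\<^bsub>?K\<^esub>" if "k > 0" for k :: nat
    using rat_ring_char0[OF that] inj_on_eq_iff[OF \<phi>] by (simp add: image_ring_zero)
  then show ?thesis using K.field_axioms by blast
qed

lemma residue_ring_prime:
  assumes "Factorial_Ring.prime (p::nat)"
  shows "cring (residue_ring (int p))" and "finite (carrier (residue_ring (int p)))"
    and "[p] \<cdot>\<^bsub>residue_ring (int p)\<^esub> \<one>\<^bsub>residue_ring (int p)\<^esub> = \<zero>\<^bsub>residue_ring (int p)\<^esub>"
    and "\<one>\<^bsub>residue_ring (int p)\<^esub> \<noteq> \<zero>\<^bsub>residue_ring (int p)\<^esub>"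
proof -
  have "int p > 1" using assms prime_gt_1_nat by fastforce
  then interpret residues "int p" "residue_ring (int p)" by unfold_locales simp_all
  show "cring (residue_ring (int p))" by (rule is_cring)
  show "finite (carrier (residue_ring (int p)))" by (rule finite)
  have "[k] \<cdot>\<^bsub>residue_ring (int p)\<^esub> \<one>\<^bsub>residue_ring (int p)\<^esub> = int k mod int p" for k :: nat
  proof (induction k)
    case (Suc k)
    then show ?case by (simp add: res_one_eq res_add_eq mod_add_right_eq add.commute)
  qed (simp add: res_zero_eq)
  then show "[p] \<cdot>\<^bsub>residue_ring (int p)\<^esub> \<one>\<^bsub>residue_ring (int p)\<^esub> = \<zero>\<^bsub>residue_ring (int p)\<^esub>"
    by (simp add: res_zero_eq)
  show "\<one>\<^bsub>residue_ring (int p)\<^esub> \<noteq> \<zero>\<^bsub>residue_ring (int p)\<^esub>"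
    by (simp add: res_one_eq res_zero_eq)
qed

text \<open>The injective homomorphism \<open>\<phi>\<close> preserves what makes the counterexample
  work: square zero, component \<open>\<one>\<close> in degree \<open>0\<close>, and
  \<open>\<one> \<noteq> \<zero>\<close>.\<close>

lemma exists_graded_ring_radicals_not_graded:
  assumes inf: "infinite (UNIV :: 'r set)"
    and H: "add_subgroup H" "finite (H :: 'g::ab_group_add set)" "Factorial_Ring.prime (card H)"
  shows "\<exists>(S :: 'r ring) (B :: 'g \<Rightarrow> 'r set). graded_cring S B \<and>
    \<not> graded_ideal S B (nilradical S) \<and> \<not> graded_ideal S B (jacobson_radical S)"
proof -
  let ?R = "residue_ring (int (card H))"
  let ?G = "group_ring TYPE('g) ?R"
  note R = residue_ring_prime[OF H(3)]
  interpret R: cring ?R by (rule R(1))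
  interpret G: cring ?G by (rule R.group_ring_cring)
  define f where "f = R.const_on H \<one>\<^bsub>?R\<^esub>"
  have f: "f \<in> carrier ?G" unfolding f_def by (rule R.const_on_closed[OF H(2) R.one_closed])
  note w = R.group_ring_radicals_not_graded_witness[OF H(1,2) R(3,4), where T = "TYPE('g)", folded f_def]
  obtain S :: "'r ring" and B \<phi> C where S: "graded_cring S B" and hom: "\<phi> \<in> ring_hom (?G\<lparr>carrier := C\<rparr>) S"
    and inj: "inj_on \<phi> C" and fC: "f \<in> C" and C: "subring C ?G"
    and decomp: "homogeneous_decomp S B (\<phi> f) (\<lambda>n. \<phi> (gmonom ?R (f n) n))"
    using R.transport_supported_on[OF countable_finite[OF R(2)] H(1,2) inf f]
    unfolding f_def R.const_on_def by auto
  interpret S: graded_cring S B by (rule S)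
  have ring: "ring (?G\<lparr>carrier := C\<rparr>)"
    using G.subring_iff[OF subringE(1)[OF C]] C by blast
  have zero: "\<phi> \<zero>\<^bsub>?G\<^esub> = \<zero>\<^bsub>S\<^esub>" using ring_hom_zero[OF hom ring S.ring_axioms] by simp
  have one: "\<phi> \<one>\<^bsub>?G\<^esub> = \<one>\<^bsub>S\<^esub>" using ring_hom_one[OF hom] by simp
  have "\<phi> f \<otimes>\<^bsub>S\<^esub> \<phi> f = \<zero>\<^bsub>S\<^esub>" using ring_hom_mult[OF hom, of f f] fC w(1) zero by simp
  moreover have "\<phi> f \<in> carrier S" using ring_hom_closed[OF hom, of f] fC by simp
  moreover have "\<phi> (gmonom ?R (f 0) 0) = \<one>\<^bsub>S\<^esub>" unfolding w(2) by (rule one)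
  moreover have "\<one>\<^bsub>S\<^esub> \<noteq> \<zero>\<^bsub>S\<^esub>"
    using inj_onD[OF inj, of "\<one>\<^bsub>?G\<^esub>" "\<zero>\<^bsub>?G\<^esub>"] subringE(2,3)[OF C] w(3) zero one by auto
  ultimately show ?thesis using S.radicals_not_graded[OF _ _ decomp] S by blast
qed

text \<open>The averaging idempotent over the rationals has a nonzero component in degree
  \<open>y \<noteq> 0\<close>. It stays nonzero under the injective map \<open>\<phi>\<close>,
  whereas an element of \<open>B 0\<close> has zero component there.\<close>

lemma exists_graded_ring_nontrivial_idempotent:
  assumes inf: "infinite (UNIV :: 'r set)"
    and H: "add_subgroup H" "finite (H :: 'g::ab_group_add set)" and y: "y \<in> H" "y \<noteq> 0"
  shows "\<exists>(S :: 'r ring) (B :: 'g \<Rightarrow> 'r set). graded_cring S B \<and> \<not> idempotents S \<subseteq> B 0"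
proof -
  interpret Q: Ring.field rat_ring by (rule field_from_type_algebra)
  let ?G = "group_ring TYPE('g) rat_ring"
  interpret G: cring ?G by (rule Q.group_ring_cring)
  obtain e where e: "e \<in> idempotents ?G" "\<And>x. x \<notin> H \<Longrightarrow> e x = \<zero>\<^bsub>rat_ring\<^esub>" "e y \<noteq> \<zero>\<^bsub>rat_ring\<^esub>"
    using Q.idempotent_supported_on_subgroup[OF H y rat_ring_char0] by auto
  have ec: "e \<in> carrier ?G" "e \<otimes>\<^bsub>?G\<^esub> e = e" using e(1) unfolding idempotents_def by auto
  obtain S :: "'r ring" and B \<phi> C where S: "graded_cring S B" and hom: "\<phi> \<in> ring_hom (?G\<lparr>carrier := C\<rparr>) S"
    and inj: "inj_on \<phi> C" and eC: "e \<in> C" and C: "subring C ?G" and comp: "gmonom rat_ring (e y) y \<in> C"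
    and decomp: "homogeneous_decomp S B (\<phi> e) (\<lambda>n. \<phi> (gmonom rat_ring (e n) n))"
    using Q.transport_supported_on[OF _ H inf ec(1) e(2)] by auto
  interpret S: graded_cring S B by (rule S)
  have ring: "ring (?G\<lparr>carrier := C\<rparr>)"
    using G.subring_iff[OF subringE(1)[OF C]] C by blast
  have zero: "\<phi> \<zero>\<^bsub>?G\<^esub> = \<zero>\<^bsub>S\<^esub>" using ring_hom_zero[OF hom ring S.ring_axioms] by simp
  have idem: "\<phi> e \<in> idempotents S"
    unfolding idempotents_def
    using ring_hom_mult[OF hom, of e e] ring_hom_closed[OF hom, of e] eC ec(2) by simp
  have "gmonom rat_ring (e y) y y \<noteq> \<zero>\<^bsub>?G\<^esub> y" using e(3) by (simp add: gmonom_def group_ring_simps(3))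
  then have "gmonom rat_ring (e y) y \<noteq> \<zero>\<^bsub>?G\<^esub>" by metis
  then have nz: "\<phi> (gmonom rat_ring (e y) y) \<noteq> \<zero>\<^bsub>S\<^esub>"
    using inj_onD[OF inj _ comp subringE(2)[OF C]] zero by auto
  have "\<phi> e \<notin> B 0"
  proof
    assume "\<phi> e \<in> B 0"
    then have "S.cmp (\<phi> e) y = \<zero>\<^bsub>S\<^esub>" using S.cmp_homogeneous y(2) by simp
    moreover have "S.cmp (\<phi> e) = (\<lambda>n. \<phi> (gmonom rat_ring (e n) n))"
      using S.homogeneous_decomp_imp_cmp[OF _ decomp] idem unfolding idempotents_def by blast
    ultimately show False using nz by simp
  qed
  then show ?thesis using S idem by blast
qed

text \<open>After a case distinction on \<open>totally_orderable\<close> each equivalence has a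
  left-hand side of known truth value, so the right-hand sides are proved or refuted one by
  one.\<close>

lemma both_imp_iff: "P \<Longrightarrow> Q \<Longrightarrow> P \<longleftrightarrow> Q" by blast
lemma neither_imp_iff: "\<not> P \<Longrightarrow> \<not> Q \<Longrightarrow> P \<longleftrightarrow> Q" by blast

theorem theorem7p16:
  assumes "infinite (UNIV :: 'r set)"
  shows
    "(totally_orderable TYPE('g::ab_group_add) \<longleftrightarrow>
      torsion_free TYPE('g)) \<and>
     (totally_orderable TYPE('g) \<longleftrightarrow>
      (\<forall>(R :: 'r ring) (A :: 'g \<Rightarrow> 'r set). graded_cring R A \<longrightarrow>
        graded_ideal R A (nilradical R))) \<and>
     (totally_orderable TYPE('g) \<longleftrightarrow>
      (\<forall>p::nat. Factorial_Ring.prime p \<longrightarrow>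
        graded_ideal (group_ring TYPE('g) (residue_ring (int p))) (group_ring_component (residue_ring (int p)))
          (nilradical (group_ring TYPE('g) (residue_ring (int p)))))) \<and>
     (totally_orderable TYPE('g) \<longleftrightarrow>
      (\<forall>(R :: 'r ring) (A :: 'g \<Rightarrow> 'r set). graded_cring R A \<longrightarrow>
        graded_ideal R A (jacobson_radical R))) \<and>
     (totally_orderable TYPE('g) \<longleftrightarrow>
      (\<forall>p::nat. Factorial_Ring.prime p \<longrightarrow>
        graded_ideal (group_ring TYPE('g) (residue_ring (int p))) (group_ring_component (residue_ring (int p)))
          (jacobson_radical (group_ring TYPE('g) (residue_ring (int p)))))) \<and>
     (totally_orderable TYPE('g) \<longleftrightarrow>
      (\<forall>(R :: 'r ring) (A :: 'g \<Rightarrow> 'r set). graded_cring R A \<longrightarrow>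
        idempotents R \<subseteq> A 0)) \<and>
     (totally_orderable TYPE('g) \<longleftrightarrow>
      (\<forall>R :: 'r ring. cring R \<longrightarrow>
        idempotents (group_ring TYPE('g) R) \<subseteq> group_ring_component R 0)) \<and>
     (totally_orderable TYPE('g) \<longleftrightarrow>
      (\<forall>K :: 'r ring. field K \<longrightarrow>
        idempotents (group_ring TYPE('g) K)
        \<subseteq> {\<zero>\<^bsub>group_ring TYPE('g) K\<^esub>, \<one>\<^bsub>group_ring TYPE('g) K\<^esub>})) \<and>
     (totally_orderable TYPE('g) \<longleftrightarrow>
      idempotents (group_ring TYPE('g) rat_ring)
        \<subseteq> {\<zero>\<^bsub>group_ring TYPE('g) rat_ring\<^esub>, \<one>\<^bsub>group_ring TYPE('g) rat_ring\<^esub>}) \<and>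
     (totally_orderable TYPE('g) \<longleftrightarrow>
      (\<forall>R :: 'r ring. domain R \<longrightarrow> domain (group_ring TYPE('g) R))) \<and>
     (totally_orderable TYPE('g) \<longleftrightarrow>
      domain (group_ring TYPE('g) rat_ring)) \<and>
     (totally_orderable TYPE('g) \<longleftrightarrow>
      (\<forall>R :: 'r ring. domain R \<longrightarrow>
        Units (group_ring TYPE('g) R) = {gmonom R r g | r g. r \<in> Units R})) \<and>
     (totally_orderable TYPE('g) \<longleftrightarrow>
      Units (group_ring TYPE('g) rat_ring) = {gmonom rat_ring r g | r g. r \<noteq> 0})"
proof (cases "totally_orderable TYPE('g)")
  case True
  then obtain lt :: "'g \<Rightarrow> 'g \<Rightarrow> bool" where lt: "group_order lt" unfolding totally_orderable_iff by blast
  interpret Q: Ring.field rat_ring by (rule field_from_type_algebra)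
  have residue: "graded_cring (group_ring TYPE('g) (residue_ring (int p))) (group_ring_component (residue_ring (int p)))"
    if "Factorial_Ring.prime p" for p :: nat
    using cring.group_ring_graded[OF residue_ring_prime(1)[OF that]] .
  show ?thesis
  proof (intro conjI both_imp_iff True allI impI)
    show "torsion_free TYPE('g)" using group_order_imp_torsion_free[OF lt] .
    show "graded_ideal R A (nilradical R)" if "graded_cring R A" for R :: "'r ring" and A :: "'g \<Rightarrow> 'r set"
      using graded_cring.nilradical_graded[OF that lt] .
    show "graded_ideal (group_ring TYPE('g) (residue_ring (int p))) (group_ring_component (residue_ring (int p)))
        (nilradical (group_ring TYPE('g) (residue_ring (int p))))" if "Factorial_Ring.prime p" for p
      using graded_cring.nilradical_graded[OF residue[OF that] lt] .
    show "graded_ideal R A (jacobson_radical R)" if "graded_cring R A" for R :: "'r ring" and A :: "'g \<Rightarrow> 'r set"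
      using graded_cring.jacobson_radical_graded[OF that lt] .
    show "graded_ideal (group_ring TYPE('g) (residue_ring (int p))) (group_ring_component (residue_ring (int p)))
        (jacobson_radical (group_ring TYPE('g) (residue_ring (int p))))" if "Factorial_Ring.prime p" for p
      using graded_cring.jacobson_radical_graded[OF residue[OF that] lt] .
    show "idempotents R \<subseteq> A 0" if "graded_cring R A" for R :: "'r ring" and A :: "'g \<Rightarrow> 'r set"
      using graded_cring.idempotents_subset_component[OF that lt] .
    show "idempotents (group_ring TYPE('g) R) \<subseteq> group_ring_component R 0" if "cring R" for R :: "'r ring"
      using graded_cring.idempotents_subset_component[OF cring.group_ring_graded[OF that] lt] .
    show "idempotents (group_ring TYPE('g) K)
        \<subseteq> {\<zero>\<^bsub>group_ring TYPE('g) K\<^esub>, \<one>\<^bsub>group_ring TYPE('g) K\<^esub>}" if "field K" for K :: "'r ring"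
      using domain.idempotents_trivial[OF domain.group_ring_domain[OF field.axioms(1)[OF that] lt]] .
    show "idempotents (group_ring TYPE('g) rat_ring)
        \<subseteq> {\<zero>\<^bsub>group_ring TYPE('g) rat_ring\<^esub>, \<one>\<^bsub>group_ring TYPE('g) rat_ring\<^esub>}"
      using domain.idempotents_trivial[OF Q.group_ring_domain[OF lt]] .
    show "domain (group_ring TYPE('g) R)" if "domain R" for R :: "'r ring"
      using domain.group_ring_domain[OF that lt] .
    show "domain (group_ring TYPE('g) rat_ring)" using Q.group_ring_domain[OF lt] .
    show "Units (group_ring TYPE('g) R) = {gmonom R r g | r g. r \<in> Units R}" if "domain R" for R :: "'r ring"
      using domain.group_ring_Units[OF that lt] .
    show "Units (group_ring TYPE('g) rat_ring) = {gmonom rat_ring r g | r g. r \<noteq> 0}"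
      using Q.group_ring_Units[OF lt] unfolding rat_ring_Units by simp
  qed
next
  case False
  then have tf: "\<not> torsion_free TYPE('g)"
    using torsion_free_imp_group_order unfolding totally_orderable_iff by blast
  obtain H :: "'g set" where H: "add_subgroup H" "finite H" "Factorial_Ring.prime (card H)"
    using not_torsion_free_imp_finite_subgroup[OF tf] unfolding add_subgroup_def by blast
  obtain y where y: "y \<in> H" "y \<noteq> 0"
  proof -
    have "\<not> H \<subseteq> {0}" using prime_gt_1_nat[OF H(3)] card_mono[of "{0}" H] by auto
    then show thesis using that by blast
  qed
  let ?R = "residue_ring (int (card H))"
  note R = residue_ring_prime[OF H(3)]
  interpret R: cring ?R by (rule R(1))
  interpret G: graded_cring "group_ring TYPE('g) ?R" "group_ring_component ?R" by (rule R.group_ring_graded)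
  note w = R.group_ring_radicals_not_graded_witness[OF H(1,2) R(3,4), where T = "TYPE('g)"]
  have f: "R.const_on H \<one>\<^bsub>?R\<^esub> \<in> carrier (group_ring TYPE('g) ?R)"
    by (rule R.const_on_closed[OF H(2) R.one_closed])
  have decomp: "homogeneous_decomp (group_ring TYPE('g) ?R) (group_ring_component ?R) (R.const_on H \<one>\<^bsub>?R\<^esub>)
      (\<lambda>n. gmonom ?R (R.const_on H \<one>\<^bsub>?R\<^esub> n) n)"
    unfolding R.group_ring_homogeneous_decomp_iff[OF f] ..
  \<comment> \<open>The single prime \<open>card H\<close> refutes the assertions quantified over
    all primes.\<close>
  note residue = G.radicals_not_graded[OF f w(1) decomp w(2,3)]
  interpret Q: Ring.field rat_ring by (rule field_from_type_algebra)
  obtain K :: "'r ring" where K: "Ring.field K"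
    and char0: "\<And>k::nat. k > 0 \<Longrightarrow> [k] \<cdot>\<^bsub>K\<^esub> \<one>\<^bsub>K\<^esub> \<noteq> \<zero>\<^bsub>K\<^esub>"
    using exists_char0_field[OF assms] by blast
  interpret K: Ring.field K by (rule K)
  note Kw = H(1,2) y char0 and Qw = H(1,2) y rat_ring_char0
  \<comment> \<open>The unit found differs from every monomial, whatever its coefficient, so it
    refutes this description of the units.\<close>
  have K_Units: "Units (group_ring TYPE('g) K) \<noteq> {gmonom K r g | r g. r \<in> Units K}"
    using K.nontrivial_unit[OF Kw] by blast
  have Q_Units: "Units (group_ring TYPE('g) rat_ring) \<noteq> {gmonom rat_ring r g | r g. r \<noteq> 0}"
    using Q.nontrivial_unit[OF Qw] by (auto simp: rat_ring_simps)
  show ?thesis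
    by (intro conjI neither_imp_iff False)
      (use tf exists_graded_ring_radicals_not_graded[OF assms H]
        exists_graded_ring_nontrivial_idempotent[OF assms H(1,2) y] residue H(3)
        K.nontrivial_idempotent[OF Kw] K.nontrivial_idempotent'[OF Kw] K.group_ring_not_domain[OF Kw]
        Q.nontrivial_idempotent'[OF Qw] Q.group_ring_not_domain[OF Qw]
        K_Units Q_Units K.is_cring K.domain_axioms K in \<open>blast+\<close>)
qed

end
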